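(* Let $\mathcal{A}$ be a unital $C^{*}$-algebra with 2-dimensional trace space, and suppose that $T(\mathcal{A})$ is faithful. Write $\partial_{e}T(\mathcal{A})=\{\varphi_{1},\varphi_{2}\}$ and put $\varphi=\frac{1}{2}(\varphi_{1}+\varphi_{2})$. Then $F(\mathcal{A})\subset F(\overline{\pi_{\varphi}(\mathcal{A})}^{w})$.
   Context: $T(\mathcal{A})$ is the tracial state space of $\mathcal{A}$, $\partial_{e}T(\mathcal{A})$ its set of extreme points, and "2-dimensional trace space" means $\dim\operatorname{lin}_{\mathbb{C}}T(\mathcal{A})=2$. $T(\mathcal{A})$ is faithful if a positive $a\in\mathcal{A}$ with $\psi(a)=0$ for every $\psi\in T(\mathcal{A})$ must be $0$. $\pi_{\varphi}$ is the GNS representation of $\mathcal{A}$ on $\mathcal{H}_{\varphi}$ and $\overline{\pi_{\varphi}(\mathcal{A})}^{w}$ is the weak closure of $\pi_{\varphi}(\mathcal{A})$ in the bounded operators on $\mathcal{H}_{\varphi}$. It is a finite von Neumann algebra which is a direct sum of two finite factors, identified with $\overline{\pi_{\varphi_{1}}(\mathcal{A})}^{w}\oplus\overline{\pi_{\varphi_{2}}(\mathcal{A})}^{w}$; its two summands are ordered accordingly, so that its extremal tracial states $\overline{\varphi}_{1},\overline{\varphi}_{2}$ satisfy $\overline{\varphi}_{i}\circ\pi_{\varphi}=\varphi_{i}$. Fundamental groups. Let $\mathcal{B}$ be either the unital $C^{*}$-algebra $\mathcal{A}$ or the von Neumann algebra $\overline{\pi_{\varphi}(\mathcal{A})}^{w}$,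 and let $(\psi_{1},\psi_{2})$ be the ordered basis $(\varphi_1,\varphi_2)$, resp. $(\overline{\varphi}_{1},\overline{\varphi}_{2})$, of $\operatorname{lin}_{\mathbb{C}}T(\mathcal{B})$. A self-similar triple for $\mathcal{B}$ is $(k,p,\Phi)$ with $k$ a natural number, $p$ a projection in $M_{k}(\mathcal{B})$ (a full projection in the case $\mathcal{B}=\mathcal{A}$, i.e. one whose closed two-sided ideal in $M_{k}(\mathcal{A})$ is all of $M_{k}(\mathcal{A})$) and $\Phi$ an isomorphism from $\mathcal{B}$ onto $pM_{k}(\mathcal{B})p$. Put $T_{(k,p,\Phi)}(\psi)=({\rm Tr}_{k}\otimes\psi)\circ\Phi$, where $({\rm Tr}_{k}\otimes\psi)((x_{ij}))=\sum_{i}\psi(x_{ii})$. $F(\mathcal{B})\subset M_{2}(\mathbb{C})$ is the set of matrices $S(T)$ for $T=T_{(k,p,\Phi)}$ with $(k,p,\Phi)$ a self-similar triple, where $S(T)e_{i}=\sum_{j}a_{ij}e_{j}$ if $T\psi_{i}=\sum_{j}a_{ij}\psi_{j}$. *)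

theory Defs
  imports
    "HOL-Analysis.Analysis"
    "HOL-Library.Function_Algebras"
    "Jordan_Normal_Form.Matrix"
begin

section \<open>Complex \<open>*\<close>-algebras, \<open>C\<^sup>*\<close>-algebras and Hilbert spaces\<close>

class complex_vector = real_vector +
  fixes scaleC :: "complex \<Rightarrow> 'a \<Rightarrow> 'a" (infixr "*\<^sub>C" 75)
  assumes scaleC_add_right: "c *\<^sub>C (x + y) = c *\<^sub>C x + c *\<^sub>C y"
    and scaleC_add_left: "(c + d) *\<^sub>C x = c *\<^sub>C x + d *\<^sub>C x"
    and scaleC_scaleC: "c *\<^sub>C d *\<^sub>C x = (c * d) *\<^sub>C x"
    and scaleC_of_real: "complex_of_real r *\<^sub>C x = r *\<^sub>R x"

text \<open>Unital complex \<open>*\<close>-algebras. The zero algebra is not excluded.\<close>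

class complex_star_algebra = complex_vector + Rings.ring + monoid_mult +
  fixes star :: "'a \<Rightarrow> 'a"
  assumes mult_scaleC_left: "(c *\<^sub>C x) * y = c *\<^sub>C (x * y)"
    and mult_scaleC_right: "x * (c *\<^sub>C y) = c *\<^sub>C (x * y)"
    and star_add: "star (x + y) = star x + star y"
    and star_scaleC: "star (c *\<^sub>C x) = cnj c *\<^sub>C star x"
    and star_mult: "star (x * y) = star y * star x"
    and star_star: "star (star x) = x"

class unital_cstar_algebra = complex_star_algebra + real_normed_algebra + banach +
  assumes norm_scaleC: "norm (c *\<^sub>C x) = cmod c * norm x"
    and cstar_identity: "norm (star x * x) = (norm x)\<^sup>2"

text \<open>The inner product \<open>cinner\<close> is linear in the first argument; \<open>real_inner\<close> supplies the norm
  through \<open>inner = Re \<circ> cinner\<close>.\<close>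

class complex_hilbert_space = complex_vector + real_inner + banach +
  fixes cinner :: "'a \<Rightarrow> 'a \<Rightarrow> complex"
  assumes cinner_commute: "cinner x y = cnj (cinner y x)"
    and cinner_add_left: "cinner (x + y) z = cinner x z + cinner y z"
    and cinner_scaleC_left: "cinner (c *\<^sub>C x) y = c * cinner x y"
    and Re_cinner: "Re (cinner x y) = inner x y"


section \<open>Bounded operators on a Hilbert space\<close>

lemma riesz_real:
  fixes g :: "'a::{real_inner, banach} \<Rightarrow> real"
  assumes "bounded_linear g"
  shows "\<exists>z. \<forall>x. g x = inner x z"
proof (cases "\<forall>x. g x = 0")
  case True
  then show ?thesis by (intro exI[of _ 0]) auto
next
  case False
  interpret g: bounded_linear g by fact
  define S where "S = {x. g x = 1}"
  from False obtain u where u: "g u \<noteq> 0" by blast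
  then have "(1 / g u) *\<^sub>R u \<in> S" by (simp add: S_def g.scaleR)
  then have S_ne: "S \<noteq> {}" by blast
  define d where "d = (INF x\<in>S. norm x)"
  have bdd: "bdd_below (norm ` S)" by (auto intro: bdd_belowI[of _ 0])
  have d_le: "d \<le> norm x" if "x \<in> S" for x
    unfolding d_def by (rule cINF_lower[OF bdd that])
  have d_nonneg: "0 \<le> d" unfolding d_def by (rule cINF_greatest[OF S_ne]) simp
  have "\<exists>x\<in>S. norm x < d + 1 / Suc n" for n
    using cINF_less_iff[OF S_ne bdd, of "d + 1 / Suc n"] unfolding d_def by auto
  then obtain X where XS: "\<And>n. X n \<in> S" and Xd: "\<And>n. norm (X n) < d + 1 / Suc n" by metis
  have norm_lim: "(\<lambda>n. norm (X n)) \<longlonglongrightarrow> d"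
  proof (rule tendsto_sandwich)
    show "\<forall>\<^sub>F n in sequentially. d \<le> norm (X n)" using d_le XS by auto
    show "\<forall>\<^sub>F n in sequentially. norm (X n) \<le> d + 1 / Suc n"
      by (intro always_eventually allI less_imp_le Xd)
    show "(\<lambda>n. d + 1 / real (Suc n)) \<longlonglongrightarrow> d"
      using tendsto_add[OF tendsto_const LIMSEQ_inverse_real_of_nat, of d]
      by (simp add: inverse_eq_divide)
  qed simp
  have par: "(norm (x - y))\<^sup>2 \<le> 2 * (norm x)\<^sup>2 + 2 * (norm y)\<^sup>2 - 4 * d\<^sup>2"
    if "x \<in> S" "y \<in> S" for x y
  proof -
    have "(1/2) *\<^sub>R (x + y) \<in> S" using that by (simp add: S_def g.scaleR g.add)
    then have "d \<le> norm ((1/2) *\<^sub>R (x + y))" by (rule d_le)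
    then have "2 * d \<le> norm (x + y)" by simp
    then have "(2 * d)\<^sup>2 \<le> (norm (x + y))\<^sup>2" using d_nonneg by (intro power_mono) auto
    moreover have "(norm (x - y))\<^sup>2 + (norm (x + y))\<^sup>2 = 2 * (norm x)\<^sup>2 + 2 * (norm y)\<^sup>2"
      by (simp add: power2_norm_eq_inner inner_simps inner_commute)
    ultimately show ?thesis by (simp add: power_mult_distrib)
  qed
  have "Cauchy X"
  proof (rule metric_CauchyI)
    fix e :: real assume e: "0 < e"
    have "(\<lambda>n. (norm (X n))\<^sup>2) \<longlonglongrightarrow> d\<^sup>2" by (intro tendsto_intros norm_lim)
    moreover have "d\<^sup>2 < d\<^sup>2 + e\<^sup>2 / 4" using e by simp
    ultimately have "\<forall>\<^sub>F n in sequentially. (norm (X n))\<^sup>2 < d\<^sup>2 + e\<^sup>2 / 4"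
      by (rule order_tendstoD(2))
    then obtain N where N: "\<And>n. n \<ge> N \<Longrightarrow> (norm (X n))\<^sup>2 < d\<^sup>2 + e\<^sup>2 / 4"
      by (auto simp: eventually_sequentially)
    show "\<exists>M. \<forall>m\<ge>M. \<forall>n\<ge>M. dist (X m) (X n) < e"
    proof (intro exI allI impI)
      fix m n assume "N \<le> m" "N \<le> n"
      then have "(norm (X m - X n))\<^sup>2 < e\<^sup>2"
        using par[OF XS XS, of m n] N[of m] N[of n] by linarith
      then show "dist (X m) (X n) < e"
        using e by (simp add: dist_norm power2_less_imp_less)
    qed
  qed
  then obtain z where z: "X \<longlonglongrightarrow> z" using Cauchy_convergent convergent_def by blast
  have "(\<lambda>n. g (X n)) \<longlonglongrightarrow> g z" by (rule g.tendsto[OF z])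
  moreover have "g (X n) = 1" for n using XS by (simp add: S_def)
  ultimately have gz: "g z = 1" by (simp add: LIMSEQ_const_iff)
  have nz: "norm z = d" using LIMSEQ_unique[OF tendsto_norm[OF z] norm_lim] .
  have orth: "inner v z = 0" if v: "g v = 0" for v
  proof (rule ccontr)
    assume ne: "inner v z \<noteq> 0"
    then have "v \<noteq> 0" by auto
    define t where "t = - inner v z / inner v v"
    have "z + t *\<^sub>R v \<in> S" using v gz by (simp add: S_def g.add g.scaleR)
    then have "norm z \<le> norm (z + t *\<^sub>R v)" using d_le nz by simp
    then have "(norm z)\<^sup>2 \<le> (norm (z + t *\<^sub>R v))\<^sup>2" by (intro power_mono) auto
    then have "0 \<le> 2 * t * inner v z + t * (t * inner v v)"
      unfolding power2_norm_eq_inner by (simp add: inner_simps inner_commute algebra_simps)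
    moreover have "t * inner v v = - inner v z" using \<open>v \<noteq> 0\<close> by (simp add: t_def)
    ultimately have "0 \<le> t * inner v z" by simp
    moreover have "t * inner v z = - ((inner v z)\<^sup>2 / inner v v)"
      by (simp add: t_def power2_eq_square)
    moreover have "(inner v z)\<^sup>2 / inner v v > 0" using ne \<open>v \<noteq> 0\<close> by simp
    ultimately show False by linarith
  qed
  have "z \<noteq> 0" using gz g.zero by auto
  have "g x = inner x ((1 / inner z z) *\<^sub>R z)" for x
  proof -
    have "g (x - g x *\<^sub>R z) = 0" by (simp add: g.diff g.scaleR gz)
    then have "inner (x - g x *\<^sub>R z) z = 0" by (rule orth)
    then have "inner x z = g x * inner z z" by (simp add: inner_simps)
    then show ?thesis using \<open>z \<noteq> 0\<close> by simp
  qed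
  then show ?thesis by blast
qed

lemma scaleC_zero_right [simp]: "c *\<^sub>C (0::'a::complex_vector) = 0"
  using scaleC_add_right[of c "0::'a" 0] by simp

lemma scaleC_one [simp]: "1 *\<^sub>C (x::'a::complex_vector) = x"
  using scaleC_of_real[of 1 x] by simp

lemma scaleC_minus_right: "c *\<^sub>C (- x) = - (c *\<^sub>C (x::'a::complex_vector))"
  using scaleC_add_right[of c x "- x"] by (simp add: eq_neg_iff_add_eq_0 add.commute)

lemma scaleC_diff_right: "c *\<^sub>C (x - y) = c *\<^sub>C x - c *\<^sub>C (y::'a::complex_vector)"
  using scaleC_add_right[of c x "- y"] by (simp add: scaleC_minus_right)

lemma cinner_add_right:
  "cinner x (y + z) = cinner x y + cinner x (z::'a::complex_hilbert_space)"
  by (metis cinner_add_left cinner_commute complex_cnj_add)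

lemma cinner_scaleC_right:
  "cinner x (c *\<^sub>C y) = cnj c * cinner x (y::'a::complex_hilbert_space)"
  by (metis cinner_commute cinner_scaleC_left complex_cnj_mult)

lemma Im_cinner: "Im (cinner x y) = - inner (\<i> *\<^sub>C x) (y::'a::complex_hilbert_space)"
  by (simp flip: Re_cinner add: cinner_scaleC_left)

lemma cinner_eqI:
  fixes y z :: "'a::complex_hilbert_space"
  assumes "\<And>x. cinner x y = cinner x z"
  shows "y = z"
proof -
  have "inner (y - z) y = inner (y - z) z"
    using assms[of "y - z"] by (metis Re_cinner)
  then have "inner (y - z) (y - z) = 0" by (simp add: inner_diff_right)
  then show ?thesis by simp
qed

lemma norm_scaleC_hilbert: "norm (c *\<^sub>C x) = cmod c * norm (x::'a::complex_hilbert_space)"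
proof -
  have "Im (cinner x x) = 0"
    using arg_cong[OF cinner_commute[of x x], of Im] by simp
  then have x: "cinner x x = complex_of_real (inner x x)"
    by (simp add: complex_eq_iff Re_cinner)
  have "cinner (c *\<^sub>C x) (c *\<^sub>C x) = (c * cnj c) * cinner x x"
    by (simp add: cinner_scaleC_left cinner_scaleC_right)
  also have "\<dots> = complex_of_real ((cmod c)\<^sup>2 * inner x x)"
    by (simp add: x complex_norm_square [symmetric])
  finally have "inner (c *\<^sub>C x) (c *\<^sub>C x) = (cmod c)\<^sup>2 * inner x x"
    by (metis Re_cinner Re_complex_of_real)
  then show ?thesis by (simp add: norm_eq_sqrt_inner real_sqrt_mult)
qed

text \<open>Boundedness is stated through the underlying real-linear map.\<close>

definition bounded_clinear :: "('a::complex_hilbert_space \<Rightarrow> 'a) \<Rightarrow> bool" where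
  "bounded_clinear f \<longleftrightarrow> bounded_linear f \<and> (\<forall>c x. f (c *\<^sub>C x) = c *\<^sub>C f x)"

lemma ex1_adjoint:
  assumes "bounded_clinear f"
  shows "\<exists>!z. \<forall>x. cinner (f x) y = cinner x z"
proof (rule ex_ex1I)
  have "bounded_linear (\<lambda>x. inner (f x) y)"
    using assms unfolding bounded_clinear_def
    by (intro bounded_linear_inner_left_comp) auto
  then obtain z where z: "inner (f x) y = inner x z" for x
    using riesz_real by blast
  have "cinner (f x) y = cinner x z" for x
    using z assms by (simp add: complex_eq_iff Re_cinner Im_cinner bounded_clinear_def
        flip: z)
  then show "\<exists>z. \<forall>x. cinner (f x) y = cinner x z" by blast
qed (use cinner_eqI in metis)

definition adjoint_op :: "('a::complex_hilbert_space \<Rightarrow> 'a) \<Rightarrow> 'a \<Rightarrow> 'a" where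
  "adjoint_op f y = (THE z. \<forall>x. cinner (f x) y = cinner x z)"

lemma cinner_adjoint_op:
  assumes "bounded_clinear f"
  shows "cinner (f x) y = cinner x (adjoint_op f y)"
  using theI'[OF ex1_adjoint[OF assms, of y]] unfolding adjoint_op_def by blast

lemma bounded_clinear_adjoint_op:
  assumes f: "bounded_clinear f"
  shows "bounded_clinear (adjoint_op f)"
proof -
  note adj = cinner_adjoint_op[OF f, symmetric]
  from f obtain K where K: "\<And>x. norm (f x) \<le> norm x * K" and "K > 0"
    unfolding bounded_clinear_def by (meson bounded_linear.pos_bounded)
  have add: "adjoint_op f (x + y) = adjoint_op f x + adjoint_op f y" for x y
    by (rule cinner_eqI) (simp add: adj cinner_add_right)
  have scal: "adjoint_op f (c *\<^sub>C x) = c *\<^sub>C adjoint_op f x" for c x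
    by (rule cinner_eqI) (simp add: adj cinner_scaleC_right)
  have "norm (adjoint_op f y) \<le> norm y * K" for y
  proof (cases "adjoint_op f y = 0")
    case False
    have "(norm (adjoint_op f y))\<^sup>2 = inner (f (adjoint_op f y)) y"
      by (metis Re_cinner adj power2_norm_eq_inner)
    also have "\<dots> \<le> norm (f (adjoint_op f y)) * norm y" by (rule norm_cauchy_schwarz)
    also have "\<dots> \<le> norm (adjoint_op f y) * K * norm y" by (intro mult_right_mono K) simp
    finally show ?thesis using False by (simp add: power2_eq_square mult_ac)
  qed (use \<open>K > 0\<close> in simp)
  then have "bounded_linear (adjoint_op f)"
    by (intro bounded_linear_intro[where K = K] add)
      (metis scal scaleC_of_real)
  then show ?thesis unfolding bounded_clinear_def using scal by blast
qed

typedef (overloaded) 'h bounded_op = "{f :: 'h::complex_hilbert_space \<Rightarrow> 'h. bounded_clinear f}"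
  morphisms apply_op Abs_bounded_op
  by (rule exI[of _ "\<lambda>_. 0"]) (simp add: bounded_clinear_def)

setup_lifting type_definition_bounded_op

instantiation bounded_op :: (complex_hilbert_space) complex_star_algebra
begin

lift_definition zero_bounded_op :: "'a bounded_op" is "\<lambda>_. 0"
  by (simp add: bounded_clinear_def)

lift_definition one_bounded_op :: "'a bounded_op" is "\<lambda>x. x"
  by (simp add: bounded_clinear_def bounded_linear_ident)

lift_definition plus_bounded_op :: "'a bounded_op \<Rightarrow> 'a bounded_op \<Rightarrow> 'a bounded_op"
  is "\<lambda>f g x. f x + g x"
  by (simp add: bounded_clinear_def bounded_linear_add scaleC_add_right)

lift_definition uminus_bounded_op :: "'a bounded_op \<Rightarrow> 'a bounded_op" is "\<lambda>f x. - f x"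
  by (simp add: bounded_clinear_def bounded_linear_minus scaleC_minus_right)

lift_definition minus_bounded_op :: "'a bounded_op \<Rightarrow> 'a bounded_op \<Rightarrow> 'a bounded_op"
  is "\<lambda>f g x. f x - g x"
  by (simp add: bounded_clinear_def bounded_linear_sub scaleC_diff_right)

lift_definition times_bounded_op :: "'a bounded_op \<Rightarrow> 'a bounded_op \<Rightarrow> 'a bounded_op"
  is "\<lambda>f g x. f (g x)"
  by (simp add: bounded_clinear_def bounded_linear_compose)

lift_definition scaleC_bounded_op :: "complex \<Rightarrow> 'a bounded_op \<Rightarrow> 'a bounded_op"
  is "\<lambda>c f x. c *\<^sub>C f x"
proof -
  fix c and f :: "'a \<Rightarrow> 'a" assume f: "bounded_clinear f"
  have "bounded_linear (\<lambda>x::'a. c *\<^sub>C x)"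
    by (rule bounded_linear_intro[where K = "cmod c"])
      (simp_all add: scaleC_add_right norm_scaleC_hilbert scaleC_scaleC mult.commute
        flip: scaleC_of_real)
  then show "bounded_clinear (\<lambda>x. c *\<^sub>C f x)"
    using f by (simp add: bounded_clinear_def bounded_linear_compose scaleC_scaleC mult.commute)
qed

lift_definition scaleR_bounded_op :: "real \<Rightarrow> 'a bounded_op \<Rightarrow> 'a bounded_op"
  is "\<lambda>r f x. r *\<^sub>R f x"
proof -
  fix r and f :: "'a \<Rightarrow> 'a" assume f: "bounded_clinear f"
  then have "bounded_linear (\<lambda>x. r *\<^sub>R f x)"
    by (simp add: bounded_clinear_def bounded_linear_const_scaleR)
  then show "bounded_clinear (\<lambda>x. r *\<^sub>R f x)"
    using f by (simp add: bounded_clinear_def scaleC_scaleC mult.commute flip: scaleC_of_real)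
qed

lift_definition star_bounded_op :: "'a bounded_op \<Rightarrow> 'a bounded_op" is adjoint_op
  by (rule bounded_clinear_adjoint_op)

instance
proof
  fix a b c :: "'a bounded_op" and r s :: real and u v :: complex
  show "a + b + c = a + (b + c)" by transfer (simp add: add.assoc)
  show "a + b = b + a" by transfer (simp add: add.commute)
  show "0 + a = a" by transfer simp
  show "- a + a = 0" by transfer simp
  show "a - b = a + - b" by transfer simp
  show "r *\<^sub>R (a + b) = r *\<^sub>R a + r *\<^sub>R b" by transfer (simp add: scaleR_add_right)
  show "(r + s) *\<^sub>R a = r *\<^sub>R a + s *\<^sub>R a" by transfer (simp add: scaleR_add_left)
  show "r *\<^sub>R s *\<^sub>R a = (r * s) *\<^sub>R a" by transfer simp
  show "1 *\<^sub>R a = a" by transfer simp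
  show "u *\<^sub>C (a + b) = u *\<^sub>C a + u *\<^sub>C b" by transfer (simp add: scaleC_add_right)
  show "(u + v) *\<^sub>C a = u *\<^sub>C a + v *\<^sub>C a" by transfer (simp add: scaleC_add_left)
  show "u *\<^sub>C v *\<^sub>C a = (u * v) *\<^sub>C a" by transfer (simp add: scaleC_scaleC)
  show "complex_of_real r *\<^sub>C a = r *\<^sub>R a" by transfer (simp add: scaleC_of_real)
  show "a * b * c = a * (b * c)" by transfer simp
  show "(a + b) * c = a * c + b * c" by transfer simp
  show "a * (b + c) = a * b + a * c"
    by transfer (simp add: bounded_clinear_def linear_simps)
  show "1 * a = a" by transfer simp
  show "a * 1 = a" by transfer simp
  show "(u *\<^sub>C a) * b = u *\<^sub>C (a * b)" by transfer simp
  show "a * (u *\<^sub>C b) = u *\<^sub>C (a * b)" by transfer (simp add: bounded_clinear_def)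
  note adj = cinner_adjoint_op[symmetric]
  show "star (a + b) = star a + star b"
  proof transfer
    fix f g :: "'a \<Rightarrow> 'a" assume f: "bounded_clinear f" and g: "bounded_clinear g"
    then have fg: "bounded_clinear (\<lambda>x. f x + g x)"
      by (simp add: bounded_clinear_def bounded_linear_add scaleC_add_right)
    show "adjoint_op (\<lambda>x. f x + g x) = (\<lambda>x. adjoint_op f x + adjoint_op g x)"
      by (rule ext, rule cinner_eqI)
        (simp add: cinner_add_right cinner_add_left adj[OF f] adj[OF g] adj[OF fg])
  qed
  show "star (u *\<^sub>C a) = cnj u *\<^sub>C star a"
  proof -
    have "apply_op (star (u *\<^sub>C a)) y = apply_op (cnj u *\<^sub>C star a) y" for y
    proof (rule cinner_eqI)
      fix x
      have "cinner x (apply_op (star (u *\<^sub>C a)) y) = cinner (apply_op (u *\<^sub>C a) x) y"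
        using apply_op[of "u *\<^sub>C a"] by (simp add: star_bounded_op.rep_eq adj)
      also have "\<dots> = u * cinner (apply_op a x) y"
        by (simp add: scaleC_bounded_op.rep_eq cinner_scaleC_left)
      also have "\<dots> = cinner x (apply_op (cnj u *\<^sub>C star a) y)"
        using apply_op[of a]
        by (simp add: scaleC_bounded_op.rep_eq star_bounded_op.rep_eq cinner_scaleC_right adj)
      finally show "cinner x (apply_op (star (u *\<^sub>C a)) y)
        = cinner x (apply_op (cnj u *\<^sub>C star a) y)" .
    qed
    then show ?thesis by (simp add: fun_eq_iff flip: apply_op_inject)
  qed
  show "star (a * b) = star b * star a"
  proof transfer
    fix f g :: "'a \<Rightarrow> 'a" assume f: "bounded_clinear f" and g: "bounded_clinear g"
    then have fg: "bounded_clinear (\<lambda>x. f (g x))"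
      by (simp add: bounded_clinear_def bounded_linear_compose)
    show "adjoint_op (\<lambda>x. f (g x)) = (\<lambda>x. adjoint_op g (adjoint_op f x))"
      by (rule ext, rule cinner_eqI) (simp add: adj[OF f] adj[OF g] adj[OF fg])
  qed
  show "star (star a) = a"
  proof transfer
    fix f :: "'a \<Rightarrow> 'a" assume f: "bounded_clinear f"
    note f' = bounded_clinear_adjoint_op[OF f]
    show "adjoint_op (adjoint_op f) = f"
    proof (rule ext, rule cinner_eqI)
      fix x y
      have "cinner x (adjoint_op (adjoint_op f) y) = cinner (adjoint_op f x) y"
        by (rule adj[OF f'])
      also have "\<dots> = cnj (cinner y (adjoint_op f x))" by (rule cinner_commute)
      also have "\<dots> = cnj (cinner (f y) x)" by (simp add: adj[OF f])
      also have "\<dots> = cinner x (f y)" by (rule cinner_commute[symmetric])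
      finally show "cinner x (adjoint_op (adjoint_op f) y) = cinner x (f y)" .
    qed
  qed
qed

end

lemma cinner_star_op: "cinner (apply_op T x) y = cinner x (apply_op (star T) y)"
  using apply_op[of T] by (simp add: star_bounded_op.rep_eq cinner_adjoint_op)

definition weak_operator_topology :: "'h::complex_hilbert_space bounded_op topology" where
  "weak_operator_topology =
     pullback_topology UNIV (\<lambda>T (v, w). cinner (apply_op T v) w)
       (product_topology (\<lambda>_. euclidean) UNIV)"


section \<open>Tracial states\<close>

text \<open>In the following, \<open>B\<close> is a unital \<open>*\<close>-subalgebra of a \<open>*\<close>-algebra given as a type:
  \<open>UNIV\<close> for a \<open>C\<^sup>*\<close>-algebra, a von Neumann algebra inside the bounded operators.
  Functionals on \<open>B\<close> are represented by functions that vanish outside \<open>B\<close>, so that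
  equality of functionals on \<open>B\<close> is equality of functions.\<close>

definition functionals_on :: "'b::complex_star_algebra set \<Rightarrow> ('b \<Rightarrow> complex) set" where
  "functionals_on B = {\<psi>. (\<forall>x\<in>B. \<forall>y\<in>B. \<psi> (x + y) = \<psi> x + \<psi> y) \<and>
     (\<forall>c. \<forall>x\<in>B. \<psi> (c *\<^sub>C x) = c * \<psi> x) \<and> (\<forall>x. x \<notin> B \<longrightarrow> \<psi> x = 0)}"

definition positive_elements :: "'b::complex_star_algebra set \<Rightarrow> 'b set" where
  "positive_elements B = {star x * x | x. x \<in> B}"

definition tracial_states :: "'b::complex_star_algebra set \<Rightarrow> ('b \<Rightarrow> complex) set" where
  "tracial_states B = {\<psi> \<in> functionals_on B.
     (\<forall>a\<in>positive_elements B. \<psi> a \<in> \<real>\<^sub>\<ge>\<^sub>0) \<and> \<psi> 1 = 1 \<and>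
     (\<forall>x\<in>B. \<forall>y\<in>B. \<psi> (x * y) = \<psi> (y * x))}"

definition extreme_points :: "('b \<Rightarrow> complex) set \<Rightarrow> ('b \<Rightarrow> complex) set" where
  "extreme_points K = {\<psi> \<in> K. \<forall>\<psi>1\<in>K. \<forall>\<psi>2\<in>K. \<forall>t::real. 0 < t \<and> t < 1 \<and>
     (\<forall>x. \<psi> x = of_real t * \<psi>1 x + of_real (1 - t) * \<psi>2 x) \<longrightarrow> \<psi>1 = \<psi> \<and> \<psi>2 = \<psi>}"

definition faithful_trace_space :: "'b::complex_star_algebra set \<Rightarrow> bool" where
  "faithful_trace_space B \<longleftrightarrow>
     (\<forall>a\<in>positive_elements B. (\<forall>\<psi>\<in>tracial_states B. \<psi> a = 0) \<longrightarrow> a = 0)"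

definition scale_functional :: "complex \<Rightarrow> ('b \<Rightarrow> complex) \<Rightarrow> 'b \<Rightarrow> complex" where
  "scale_functional c \<psi> = (\<lambda>x. c * \<psi> x)"

global_interpretation functional: vector_space "scale_functional :: _ \<Rightarrow> ('b \<Rightarrow> complex) \<Rightarrow> _"
  by unfold_locales (auto simp: scale_functional_def fun_eq_iff algebra_simps)

definition lin_C :: "('b \<Rightarrow> complex) set \<Rightarrow> ('b \<Rightarrow> complex) set" where
  "lin_C K = functional.span K"


section \<open>Matrix algebras and fundamental groups\<close>

definition matrices_over :: "nat \<Rightarrow> 'b set \<Rightarrow> 'b mat set" where
  "matrices_over k B = {X \<in> carrier_mat k k. \<forall>i<k. \<forall>j<k. X $$ (i, j) \<in> B}"

definition star_mat :: "'b::complex_star_algebra mat \<Rightarrow> 'b mat" where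
  "star_mat X = mat (dim_col X) (dim_row X) (\<lambda>(i, j). star (X $$ (j, i)))"

definition scaleC_mat :: "complex \<Rightarrow> 'b::complex_star_algebra mat \<Rightarrow> 'b mat" where
  "scaleC_mat c = map_mat (scaleC c)"

definition mat_projection :: "'b::complex_star_algebra mat \<Rightarrow> bool" where
  "mat_projection p \<longleftrightarrow> p * p = p \<and> star_mat p = p"

definition corner :: "nat \<Rightarrow> 'b::complex_star_algebra set \<Rightarrow> 'b mat \<Rightarrow> 'b mat set" where
  "corner k B p = {p * X * p | X. X \<in> matrices_over k B}"

definition star_isomorphism ::
  "'b::complex_star_algebra set \<Rightarrow> 'b mat set \<Rightarrow> ('b \<Rightarrow> 'b mat) \<Rightarrow> bool" where
  "star_isomorphism B C \<Phi> \<longleftrightarrow> bij_betw \<Phi> B C \<and>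
     (\<forall>x\<in>B. \<forall>y\<in>B. \<Phi> (x + y) = \<Phi> x + \<Phi> y \<and> \<Phi> (x * y) = \<Phi> x * \<Phi> y) \<and>
     (\<forall>c. \<forall>x\<in>B. \<Phi> (c *\<^sub>C x) = scaleC_mat c (\<Phi> x)) \<and>
     (\<forall>x\<in>B. \<Phi> (star x) = star_mat (\<Phi> x))"

text \<open>The topology of the \<open>C\<^sup>*\<close>-norm of \<open>M\<^sub>k(A)\<close> is that of entrywise norm convergence, so
  norm-closedness is expressed by entrywise limits of sequences.\<close>

definition closed_mat_ideal :: "nat \<Rightarrow> 'a::unital_cstar_algebra mat set \<Rightarrow> bool" where
  "closed_mat_ideal k I \<longleftrightarrow> I \<subseteq> carrier_mat k k \<and> 0\<^sub>m k k \<in> I \<and>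
     (\<forall>X\<in>I. \<forall>Y\<in>I. X + Y \<in> I) \<and>
     (\<forall>c. \<forall>X\<in>I. scaleC_mat c X \<in> I) \<and>
     (\<forall>X\<in>I. \<forall>Y\<in>carrier_mat k k. X * Y \<in> I \<and> Y * X \<in> I) \<and>
     (\<forall>X L. (\<forall>n. X n \<in> I) \<and> L \<in> carrier_mat k k \<and>
        (\<forall>i<k. \<forall>j<k. (\<lambda>n. X n $$ (i, j)) \<longlonglongrightarrow> L $$ (i, j)) \<longrightarrow> L \<in> I)"

definition full_mat :: "nat \<Rightarrow> 'a::unital_cstar_algebra mat \<Rightarrow> bool" where
  "full_mat k p \<longleftrightarrow> \<Inter>{I. closed_mat_ideal k I \<and> p \<in> I} = carrier_mat k k"

definition self_similar_triples ::
  "'b::complex_star_algebra set \<Rightarrow> (nat \<times> 'b mat \<times> ('b \<Rightarrow> 'b mat)) set" where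
  "self_similar_triples B = {(k, p, \<Phi>). 0 < k \<and> p \<in> matrices_over k B \<and> mat_projection p \<and>
     star_isomorphism B (corner k B p) \<Phi>}"

definition full_self_similar_triples ::
  "(nat \<times> 'a::unital_cstar_algebra mat \<times> ('a \<Rightarrow> 'a mat)) set" where
  "full_self_similar_triples = {(k, p, \<Phi>) \<in> self_similar_triples UNIV. full_mat k p}"

definition Tr_tensor :: "nat \<Rightarrow> ('b \<Rightarrow> complex) \<Rightarrow> 'b mat \<Rightarrow> complex" where
  "Tr_tensor k \<psi> X = (\<Sum>i<k. \<psi> (X $$ (i, i)))"

text \<open>\<open>\<psi>s\<close> is the list of the two basis functionals. As \<open>S e\<^sub>i = \<Sum>\<^sub>j a\<^sub>i\<^sub>j e\<^sub>j\<close>, the coefficient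
  \<open>a\<^sub>i\<^sub>j\<close> stands in row \<open>j\<close> and column \<open>i\<close> of \<open>S\<close>.\<close>

definition trace_matrices ::
  "'b::complex_star_algebra set \<Rightarrow> (nat \<times> 'b mat \<times> ('b \<Rightarrow> 'b mat)) set \<Rightarrow>
   ('b \<Rightarrow> complex) list \<Rightarrow> complex mat set" where
  "trace_matrices B triples \<psi>s = {mat 2 2 (\<lambda>(j, i). a i j) | a k p \<Phi>.
     (k, p, \<Phi>) \<in> triples \<and>
     (\<forall>i<2. \<forall>x\<in>B. Tr_tensor k (\<psi>s ! i) (\<Phi> x) = (\<Sum>j<2. a i j * (\<psi>s ! j) x))}"

definition fundamental_group_cstar :: "('a::unital_cstar_algebra \<Rightarrow> complex) list \<Rightarrow> complex mat set"
  where "fundamental_group_cstar \<psi>s = trace_matrices UNIV full_self_similar_triples \<psi>s"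

definition fundamental_group_vn ::
  "'b::complex_star_algebra set \<Rightarrow> ('b \<Rightarrow> complex) list \<Rightarrow> complex mat set" where
  "fundamental_group_vn N \<psi>s = trace_matrices N (self_similar_triples N) \<psi>s"


section \<open>The GNS representation\<close>

definition unital_star_representation ::
  "('a::complex_star_algebra \<Rightarrow> 'h::complex_hilbert_space bounded_op) \<Rightarrow> bool" where
  "unital_star_representation \<pi> \<longleftrightarrow>
     (\<forall>a b. \<pi> (a + b) = \<pi> a + \<pi> b) \<and> (\<forall>c a. \<pi> (c *\<^sub>C a) = c *\<^sub>C \<pi> a) \<and>
     (\<forall>a b. \<pi> (a * b) = \<pi> a * \<pi> b) \<and> (\<forall>a. \<pi> (star a) = star (\<pi> a)) \<and> \<pi> 1 = 1"

text \<open>The cyclic representation with cyclic vector \<open>\<xi>\<close> implementing \<open>\<phi>\<close>; it is determined by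
  \<open>\<phi>\<close> up to unitary equivalence.\<close>

definition GNS_representation ::
  "('a::complex_star_algebra \<Rightarrow> complex) \<Rightarrow> ('a \<Rightarrow> 'h::complex_hilbert_space bounded_op) \<Rightarrow> 'h \<Rightarrow> bool"
  where
  "GNS_representation \<phi> \<pi> \<xi> \<longleftrightarrow> unital_star_representation \<pi> \<and>
     closure (range (\<lambda>a. apply_op (\<pi> a) \<xi>)) = UNIV \<and>
     (\<forall>a. \<phi> a = cinner (apply_op (\<pi> a) \<xi>) \<xi>)"

definition weak_closure_of_range ::
  "('a \<Rightarrow> 'h::complex_hilbert_space bounded_op) \<Rightarrow> 'h bounded_op set" where
  "weak_closure_of_range \<pi> = weak_operator_topology closure_of range \<pi>"

end

theory Submission
  imports Defs
begin

text \<open>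
  Let \<open>N\<close> be the weak closure of \<open>\<pi>(A)\<close>. A weakly continuous map is determined on \<open>N\<close> by its
  values on \<open>\<pi>(A)\<close>, so that an identity between weakly continuous maps passes from \<open>\<pi>(A)\<close> to \<open>N\<close>
  (\<open>eq_on_N\<close>), and in two variables by passing to the limit in one variable at a time. It therefore
  suffices that the traces of \<open>N\<close> and the isomorphism \<open>\<Phi>\<close> of a self-similar triple of \<open>A\<close> are
  given by weakly continuous formulas: then the projection \<open>\<pi>(p)\<close> and the extension of \<open>\<Phi>\<close> form a
  self-similar triple for \<open>N\<close> with the same coefficients.

  Traces. As \<open>\<phi>\<^sub>i \<le> 2 \<phi>\<close>, there is a positive operator \<open>h\<close> in the commutant with
  \<open>\<phi>\<^sub>i(a) = \<langle>\<pi>(a) \<xi>, h \<xi>\<rangle>\<close>, and \<open>x \<mapsto> \<langle>x \<xi>, h \<xi>\<rangle>\<close> is a normal tracial state of \<open>N\<close> that extends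
  \<open>\<phi>\<^sub>i\<close>. It is extreme: a tracial state occurring in a convex decomposition of it is dominated by
  it, hence normal, hence determined by its restriction to \<open>\<pi>(A)\<close>, which is \<open>\<phi>\<^sub>i\<close> by extremality
  (\<open>extreme_trace_extends\<close>). So \<open>\<psi>\<^sub>i\<close> is this normal extension.

  Isomorphism. By \<open>Tr \<otimes> \<phi>\<^sub>i \<circ> \<Phi> = \<Sum>\<^sub>j a\<^sub>i\<^sub>j \<phi>\<^sub>j\<close>, the 2-norms of \<open>\<Phi>(x)\<close> and of \<open>x\<close> are
  comparable as soon as the column sums of \<open>(a\<^sub>i\<^sub>j)\<close> are positive. The coefficients are nonnegative
  since \<open>\<phi>\<^sub>1\<close> and \<open>\<phi>\<^sub>2\<close> are extreme, and a column that vanishes would make the amplified traces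
  proportional on the corner; fullness, in the form \<open>1 = \<Sum>\<^sub>m a\<^sub>m p\<^sub>u\<^sub>t b\<^sub>m\<close> with entries of \<open>p\<close>, would
  then give \<open>\<phi>\<^sub>1 = \<phi>\<^sub>2\<close> (\<open>matrix_trace_comparable\<close>). Hence the entries of \<open>\<Phi>\<close>, the inverse of \<open>\<Phi>\<close>
  on matrices \<open>p E p\<close> with one-entry matrices \<open>E\<close>, and the right multiplications all induce bounded
  operators on the GNS space. The decomposition of \<open>1\<close> expresses each entry of \<open>\<pi>(\<Phi>(x))\<close> as a
  finite sum \<open>\<Sum> S \<pi>(x) T\<close> with \<open>S\<close> and \<open>T\<close> among the products of these operators, and the
  same holds for the inverse (\<open>weakly_continuous_extensions\<close>). Such sums are weakly continuous in
  the middle factor.\<close>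

section \<open>Bounded operators\<close>

lemmas op_apply [simp] = plus_bounded_op.rep_eq times_bounded_op.rep_eq scaleC_bounded_op.rep_eq
  zero_bounded_op.rep_eq one_bounded_op.rep_eq

lemma bounded_clinear_apply_op: "bounded_clinear (apply_op T)"
  using apply_op[of T] by simp

lemma apply_op_add [simp]: "apply_op T (v + w) = apply_op T v + apply_op T w"
  using bounded_clinear_apply_op[of T] by (simp add: bounded_clinear_def linear_simps)

lemma apply_op_scaleC [simp]: "apply_op T (c *\<^sub>C v) = c *\<^sub>C apply_op T v"
  using bounded_clinear_apply_op[of T] by (simp add: bounded_clinear_def)

lemma bounded_linear_apply_op: "bounded_linear (apply_op T)"
  using bounded_clinear_apply_op[of T] by (simp add: bounded_clinear_def)

lemma apply_op_sum: "apply_op (\<Sum>i\<in>I. T i) v = (\<Sum>i\<in>I. apply_op (T i) v)"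
  by (induction I rule: infinite_finite_induct) auto

lemma bounded_op_eqI: "(\<And>v. apply_op S v = apply_op T v) \<Longrightarrow> S = T"
  by (metis apply_op_inject ext)

lemma apply_op_bound:
  obtains K where "K > 0" and "\<And>v. norm (apply_op T v) \<le> K * norm v"
  using bounded_linear.pos_bounded[OF bounded_linear_apply_op[of T]]
  by (metis mult.commute)

lemma cinner_self: "cinner v v = complex_of_real ((norm v)\<^sup>2)"
proof -
  have "Im (cinner v v) = 0"
    using arg_cong[OF cinner_commute[of v v], of Im] by simp
  then show ?thesis by (simp add: complex_eq_iff Re_cinner power2_norm_eq_inner)
qed

lemma norm_cinner_le: "cmod (cinner v w) \<le> norm v * norm w"
proof (cases "cinner v w = 0")
  case False
  define c where "c = cnj (sgn (cinner v w))"
  have c: "c * cinner v w = complex_of_real (cmod (cinner v w))"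
    using False complex_norm_square[of "cinner v w"]
    by (simp add: c_def sgn_div_norm scaleR_conv_of_real power2_eq_square field_simps)
  have "cmod c = 1" using False by (simp add: c_def norm_sgn)
  have "cmod (cinner v w) = Re (cinner (c *\<^sub>C v) w)"
    by (simp add: cinner_scaleC_left c)
  also have "\<dots> \<le> norm (c *\<^sub>C v) * norm w"
    by (simp add: Re_cinner norm_cauchy_schwarz)
  finally show ?thesis using \<open>cmod c = 1\<close> by (simp add: norm_scaleC_hilbert)
qed simp

lemma bounded_linear_scaleC: "bounded_linear (\<lambda>v::'h::complex_hilbert_space. c *\<^sub>C v)"
  using bounded_linear_apply_op[of "c *\<^sub>C 1"] by simp

lemma bounded_linear_cinner_left: "bounded_linear (\<lambda>v. cinner v w)"
proof (rule bounded_linear_intro[where K = "norm w"])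
  show "cinner (r *\<^sub>R x) w = r *\<^sub>R cinner x w" for r x
    by (simp add: scaleR_conv_of_real cinner_scaleC_left flip: scaleC_of_real)
qed (simp_all add: cinner_add_left norm_cinner_le)

text \<open>The closure of a densely defined bounded graph is again a subspace that satisfies the estimate,
  and by completeness its domain is closed, hence everything. Stating this for graphs covers maps
  that are given on representatives, such as \<open>x \<xi> \<mapsto> y\<close>: well-definedness is part of the
  conclusion.\<close>

lemma bounded_graph_extends_to_operator:
  fixes V :: "('h::complex_hilbert_space \<times> 'h) set"
  assumes add: "\<And>u v u' v'. (u, v) \<in> V \<Longrightarrow> (u', v') \<in> V \<Longrightarrow> (u + u', v + v') \<in> V"
    and scale: "\<And>c u v. (u, v) \<in> V \<Longrightarrow> (c *\<^sub>C u, c *\<^sub>C v) \<in> V"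
    and bound: "\<And>u v. (u, v) \<in> V \<Longrightarrow> norm v \<le> C * norm u"
    and dense: "closure (fst ` V) = UNIV"
  shows "\<exists>F. \<forall>(u, v)\<in>V. apply_op F u = v"
proof -
  define W where "W = closure V"
  have W_add: "(u + u', v + v') \<in> W" if uv: "(u, v) \<in> W" "(u', v') \<in> W" for u v u' v'
  proof -
    obtain X Y where X: "\<And>n. X n \<in> V" "X \<longlonglongrightarrow> (u, v)" and Y: "\<And>n. Y n \<in> V" "Y \<longlonglongrightarrow> (u', v')"
      using uv unfolding W_def closure_sequential by blast
    have "X n + Y n \<in> V" for n
      using add[of "fst (X n)" "snd (X n)" "fst (Y n)" "snd (Y n)"] X(1)[of n] Y(1)[of n]
      by (simp add: plus_prod_def)
    moreover have "(\<lambda>n. X n + Y n) \<longlonglongrightarrow> (u + u', v + v')"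
      using tendsto_add[OF X(2) Y(2)] by simp
    ultimately show ?thesis
      unfolding W_def closure_sequential by (intro exI[of _ "\<lambda>n. X n + Y n"]) auto
  qed
  have W_scale: "(c *\<^sub>C u, c *\<^sub>C v) \<in> W" if uv: "(u, v) \<in> W" for c u v
  proof -
    obtain X where X: "\<And>n. X n \<in> V" "X \<longlonglongrightarrow> (u, v)"
      using uv unfolding W_def closure_sequential by blast
    have "(c *\<^sub>C fst (X n), c *\<^sub>C snd (X n)) \<in> V" for n
      using scale[of "fst (X n)" "snd (X n)" c] X(1)[of n] by simp
    moreover have "(\<lambda>n. (c *\<^sub>C fst (X n), c *\<^sub>C snd (X n))) \<longlonglongrightarrow> (c *\<^sub>C u, c *\<^sub>C v)"
      using tendsto_fst[OF X(2)] tendsto_snd[OF X(2)]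
      by (intro tendsto_Pair bounded_linear.tendsto[OF bounded_linear_scaleC]) auto
    ultimately show ?thesis
      unfolding W_def closure_sequential
      by (intro exI[of _ "\<lambda>n. (c *\<^sub>C fst (X n), c *\<^sub>C snd (X n))"]) blast
  qed
  have W_bound: "norm v \<le> C * norm u" if uv: "(u, v) \<in> W" for u v
  proof -
    obtain X where X: "\<And>n. X n \<in> V" "X \<longlonglongrightarrow> (u, v)"
      using uv unfolding W_def closure_sequential by blast
    have "norm (snd (X n)) \<le> C * norm (fst (X n))" for n
      using bound[of "fst (X n)" "snd (X n)"] X(1)[of n] by simp
    moreover have "(\<lambda>n. norm (snd (X n))) \<longlonglongrightarrow> norm v" "(\<lambda>n. C * norm (fst (X n))) \<longlonglongrightarrow> C * norm u"
      using tendsto_fst[OF X(2)] tendsto_snd[OF X(2)]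
      by (auto intro!: tendsto_intros)
    ultimately show ?thesis by (meson LIMSEQ_le)
  qed
  have W_diff: "(u - u', v - v') \<in> W" if "(u, v) \<in> W" "(u', v') \<in> W" for u v u' v'
    using W_add[OF that(1) W_scale[OF that(2), of "-1"]]
    by (simp add: scaleC_of_real[of "-1", simplified])
  have V_diff: "(u - u', v - v') \<in> V" if "(u, v) \<in> V" "(u', v') \<in> V" for u v u' v'
    using add[OF that(1) scale[OF that(2), of "-1"]]
    by (simp add: scaleC_of_real[of "-1", simplified])
  have W_total: "\<exists>v. (u, v) \<in> W" for u
  proof -
    have "u \<in> closure (fst ` V)" using dense by simp
    then obtain x where x: "\<And>n. x n \<in> fst ` V" "x \<longlonglongrightarrow> u"
      unfolding closure_sequential by blast
    then have "\<forall>n. \<exists>v. (x n, v) \<in> V" by force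
    then obtain y where y: "\<And>n. (x n, y n) \<in> V" by metis
    have "Cauchy y"
    proof (rule metric_CauchyI)
      fix e :: real assume "e > 0"
      have "Cauchy x" using x(2) LIMSEQ_imp_Cauchy by blast
      then obtain M where M: "\<And>m n. m \<ge> M \<Longrightarrow> n \<ge> M \<Longrightarrow> dist (x m) (x n) < e / (\<bar>C\<bar> + 1)"
        using \<open>e > 0\<close> metric_CauchyD[of x "e / (\<bar>C\<bar> + 1)"] by (auto simp: add_pos_nonneg)
      show "\<exists>M. \<forall>m\<ge>M. \<forall>n\<ge>M. dist (y m) (y n) < e"
      proof (intro exI allI impI)
        fix m n assume "M \<le> m" "M \<le> n"
        have "norm (y m - y n) \<le> C * norm (x m - x n)"
          by (intro bound V_diff y)
        also have "\<dots> \<le> (\<bar>C\<bar> + 1) * norm (x m - x n)"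
          by (intro mult_right_mono) auto
        also have "\<dots> < e"
          using M[OF \<open>M \<le> m\<close> \<open>M \<le> n\<close>] by (simp add: dist_norm field_simps)
        finally show "dist (y m) (y n) < e" by (simp add: dist_norm)
      qed
    qed
    then obtain v where "y \<longlonglongrightarrow> v" using Cauchy_convergent convergent_def by blast
    then have "(\<lambda>n. (x n, y n)) \<longlonglongrightarrow> (u, v)" using x(2) by (intro tendsto_Pair)
    then show ?thesis unfolding W_def closure_sequential
      using y by (intro exI[of _ v] exI[of _ "\<lambda>n. (x n, y n)"]) blast
  qed
  have W_unique: "v = v'" if "(u, v) \<in> W" "(u, v') \<in> W" for u v v'
    using W_bound[OF W_diff[OF that]] by simp
  define f where "f u = (THE v. (u, v) \<in> W)" for u
  have f: "(u, f u) \<in> W" for u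
    unfolding f_def using W_total W_unique by (metis theI')
  have f_eq: "f u = v" if "(u, v) \<in> W" for u v
    using W_unique[OF f that] .
  have f_scale: "f (c *\<^sub>C u) = c *\<^sub>C f u" for c u by (intro f_eq W_scale f)
  have "bounded_linear f"
  proof (rule bounded_linear_intro[where K = C])
    show "f (x + y) = f x + f y" for x y by (intro f_eq W_add f)
    show "f (r *\<^sub>R x) = r *\<^sub>R f x" for r x
      using f_scale[of "complex_of_real r" x] by (simp add: scaleC_of_real)
    show "norm (f x) \<le> norm x * C" for x using W_bound[OF f, of x] by (simp add: mult.commute)
  qed
  then have "bounded_clinear f" using f_scale by (simp add: bounded_clinear_def)
  then have "apply_op (Abs_bounded_op f) = f" by (simp add: Abs_bounded_op_inverse)
  moreover have "V \<subseteq> W" by (simp add: W_def closure_subset)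
  ultimately show ?thesis using f_eq by (intro exI[of _ "Abs_bounded_op f"]) auto
qed


section \<open>The weak operator topology\<close>

abbreviation "WOT \<equiv> weak_operator_topology"

lemma topspace_WOT [simp]: "topspace WOT = UNIV"
  by (simp add: weak_operator_topology_def topspace_pullback_topology)

lemma continuous_map_WOT_coefficient:
  "continuous_map WOT euclidean (\<lambda>T. cinner (apply_op T v) w)"
proof -
  have "continuous_map (product_topology (\<lambda>_. euclidean) UNIV) euclidean (\<lambda>x. x (v, w))"
    by (rule continuous_map_product_projection) simp
  from continuous_map_pullback[OF this, of UNIV "\<lambda>T (v, w). cinner (apply_op T v) w"]
  show ?thesis by (simp add: weak_operator_topology_def comp_def)
qed

lemma continuous_map_into_WOT_iff:
  "continuous_map X WOT f \<longleftrightarrow>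
     (\<forall>v w. continuous_map X euclidean (\<lambda>x. cinner (apply_op (f x) v) w))"
proof
  assume "continuous_map X WOT f"
  then show "\<forall>v w. continuous_map X euclidean (\<lambda>x. cinner (apply_op (f x) v) w)"
    using continuous_map_compose[OF _ continuous_map_WOT_coefficient] by (force simp: comp_def)
next
  assume *: "\<forall>v w. continuous_map X euclidean (\<lambda>x. cinner (apply_op (f x) v) w)"
  show "continuous_map X WOT f"
    unfolding weak_operator_topology_def
  proof (rule continuous_map_pullback')
    show "continuous_map X (product_topology (\<lambda>_. euclidean) UNIV)
      ((\<lambda>T (v, w). cinner (apply_op T v) w) \<circ> f)"
      using * by (auto simp: continuous_map_componentwise_UNIV)
  qed simp
qed

lemma continuous_map_WOT_functional:
  "continuous_map X WOT f \<Longrightarrow> continuous_map X euclidean (\<lambda>x. cinner (apply_op (f x) v) w)"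
  by (simp add: continuous_map_into_WOT_iff)

lemma continuous_map_WOT_id: "continuous_map WOT WOT (\<lambda>x. x)"
  using continuous_map_id[of WOT] by (simp add: id_def)

lemma continuous_map_WOT_const: "continuous_map X WOT (\<lambda>x. T)"
  by (simp add: continuous_map_into_WOT_iff)

lemma continuous_map_WOT_add:
  "continuous_map X WOT f \<Longrightarrow> continuous_map X WOT g \<Longrightarrow> continuous_map X WOT (\<lambda>x. f x + g x)"
  by (simp add: continuous_map_into_WOT_iff cinner_add_left continuous_map_add)

lemma continuous_map_WOT_sum:
  "(\<And>i. i \<in> I \<Longrightarrow> continuous_map X WOT (f i)) \<Longrightarrow> continuous_map X WOT (\<lambda>x. \<Sum>i\<in>I. f i x)"
  by (induction I rule: infinite_finite_induct)
    (auto intro!: continuous_map_WOT_const continuous_map_WOT_add)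

lemma continuous_map_WOT_mult_left:
  "continuous_map X WOT f \<Longrightarrow> continuous_map X WOT (\<lambda>x. A * f x)"
  by (simp add: continuous_map_into_WOT_iff cinner_star_op[of A])

lemma continuous_map_WOT_mult_right:
  "continuous_map X WOT f \<Longrightarrow> continuous_map X WOT (\<lambda>x. f x * A)"
  by (simp add: continuous_map_into_WOT_iff)

lemma continuous_map_WOT_scaleC:
  "continuous_map X WOT f \<Longrightarrow> continuous_map X WOT (\<lambda>x. c *\<^sub>C f x)"
  using continuous_map_WOT_mult_left[of X f "c *\<^sub>C 1"] by (simp add: mult_scaleC_left)

lemma cinner_star_left: "cinner (apply_op (star T) v) w = cinner v (apply_op T w)"
  using cinner_star_op[of "star T" v w] by (simp add: star_star)

lemma continuous_map_WOT_star:
  assumes "continuous_map X WOT f"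
  shows "continuous_map X WOT (\<lambda>x. star (f x))"
proof -
  have "continuous_map euclidean euclidean cnj"
    by (simp add: continuous_on_cnj)
  then have "continuous_map X euclidean (\<lambda>x. cnj (cinner (apply_op (f x) w) v))" for v w
    using continuous_map_compose[of X euclidean "\<lambda>x. cinner (apply_op (f x) w) v" euclidean cnj] assms
    by (simp add: continuous_map_into_WOT_iff comp_def)
  then show ?thesis
    by (simp add: continuous_map_into_WOT_iff cinner_star_left cinner_commute[symmetric])
qed

lemmas WOT_intros = continuous_map_WOT_id continuous_map_WOT_const continuous_map_WOT_add
  continuous_map_WOT_sum continuous_map_WOT_mult_left continuous_map_WOT_mult_right
  continuous_map_WOT_scaleC continuous_map_WOT_star


section \<open>Positive functionals and extreme traces\<close>

definition star_subalgebra :: "'b::complex_star_algebra set \<Rightarrow> bool" where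
  "star_subalgebra M \<longleftrightarrow> 1 \<in> M \<and> (\<forall>x\<in>M. \<forall>y\<in>M. x + y \<in> M \<and> x * y \<in> M) \<and>
     (\<forall>c. \<forall>x\<in>M. c *\<^sub>C x \<in> M) \<and> (\<forall>x\<in>M. star x \<in> M)"

lemma star_subalgebra_UNIV [simp]: "star_subalgebra UNIV"
  by (simp add: star_subalgebra_def)

lemma star_one [simp]: "star (1::'b::complex_star_algebra) = 1"
  by (metis mult_1_left mult_1_right star_mult star_star)

lemma star_square_expand:
  fixes x y :: "'b::complex_star_algebra"
  shows "star (x + c *\<^sub>C y) * (x + c *\<^sub>C y) =
    star x * x + c *\<^sub>C (star x * y) + cnj c *\<^sub>C (star y * x) + (c * cnj c) *\<^sub>C (star y * y)"
  by (simp add: star_add star_scaleC distrib_left distrib_right mult_scaleC_left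
      mult_scaleC_right scaleC_scaleC add_ac scaleC_add_right mult.commute)

lemma nonneg_form_Cauchy_Schwarz:
  fixes \<alpha> \<beta> \<gamma> \<delta> :: complex
  assumes "\<And>c. \<alpha> + c * \<beta> + cnj c * \<gamma> + c * cnj c * \<delta> \<in> \<real>\<^sub>\<ge>\<^sub>0"
    and \<alpha>: "\<alpha> \<in> \<real>\<^sub>\<ge>\<^sub>0" and \<delta>: "\<delta> \<in> \<real>\<^sub>\<ge>\<^sub>0"
  shows "(cmod \<gamma>)\<^sup>2 \<le> Re \<alpha> * Re \<delta>"
proof -
  have im: "Im \<alpha> = 0" "Im \<delta> = 0" and re: "Re \<alpha> \<ge> 0" "Re \<delta> \<ge> 0"
    using \<alpha> \<delta> by (auto simp: complex_nonneg_Reals_iff)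
  have 1: "\<beta> = cnj \<gamma>"
    using assms(1)[of 1] assms(1)[of \<i>] im
    by (simp add: complex_eq_iff complex_nonneg_Reals_iff)
  \<comment> \<open>The vector \<open>c = - s \<gamma>\<close> points in the direction of steepest descent; below, \<open>s\<close> is the minimizer
    \<open>1 / \<delta>\<close>, or large enough for a contradiction if \<open>\<delta> = 0\<close>.\<close>
  have *: "0 \<le> Re \<alpha> - 2 * s * (cmod \<gamma>)\<^sup>2 + s\<^sup>2 * (cmod \<gamma>)\<^sup>2 * Re \<delta>" for s :: real
  proof -
    define c where "c = - of_real s * \<gamma>"
    have "0 \<le> Re (\<alpha> + c * \<beta> + cnj c * \<gamma> + c * cnj c * \<delta>)"
      using assms(1)[of c] by (simp add: complex_nonneg_Reals_iff)
    also have "\<dots> = Re \<alpha> - 2 * s * (cmod \<gamma>)\<^sup>2 + s\<^sup>2 * (cmod \<gamma>)\<^sup>2 * Re \<delta>"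
      unfolding cmod_power2 1 c_def by (simp add: im power2_eq_square algebra_simps)
    finally show ?thesis .
  qed
  show "(cmod \<gamma>)\<^sup>2 \<le> Re \<alpha> * Re \<delta>"
  proof (cases "\<gamma> = 0")
    case False
    then have g: "(cmod \<gamma>)\<^sup>2 > 0" by simp
    show ?thesis
    proof (cases "Re \<delta> = 0")
      case True
      then show ?thesis using *[of "(Re \<alpha> + 1) / (2 * (cmod \<gamma>)\<^sup>2)"] g
        by (simp add: field_simps)
    next
      case False
      then show ?thesis using *[of "1 / Re \<delta>"] re
        by (simp add: field_simps power2_eq_square)
    qed
  qed (use re in auto)
qed

locale positive_functional =
  fixes M :: "'b::complex_star_algebra set" and \<theta> :: "'b \<Rightarrow> complex"
  assumes M: "star_subalgebra M" and functional: "\<theta> \<in> functionals_on M"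
    and positive: "\<And>x. x \<in> M \<Longrightarrow> \<theta> (star x * x) \<in> \<real>\<^sub>\<ge>\<^sub>0"
begin

lemma closed: "1 \<in> M" "x \<in> M \<Longrightarrow> y \<in> M \<Longrightarrow> x + y \<in> M" "x \<in> M \<Longrightarrow> y \<in> M \<Longrightarrow> x * y \<in> M"
    "x \<in> M \<Longrightarrow> c *\<^sub>C x \<in> M" "x \<in> M \<Longrightarrow> star x \<in> M"
  using M by (auto simp: star_subalgebra_def)

lemma linear: "x \<in> M \<Longrightarrow> y \<in> M \<Longrightarrow> \<theta> (x + y) = \<theta> x + \<theta> y" "x \<in> M \<Longrightarrow> \<theta> (c *\<^sub>C x) = c * \<theta> x"
  using functional by (auto simp: functionals_on_def)

lemma Re_star_square_nonneg: "x \<in> M \<Longrightarrow> 0 \<le> Re (\<theta> (star x * x))"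
  using positive[of x] by (simp add: complex_nonneg_Reals_iff)

lemma expand:
  assumes "x \<in> M" "y \<in> M"
  shows "\<theta> (star (x + c *\<^sub>C y) * (x + c *\<^sub>C y)) = \<theta> (star x * x) + c * \<theta> (star x * y) +
    cnj c * \<theta> (star y * x) + c * cnj c * \<theta> (star y * y)"
  unfolding star_square_expand using assms by (simp add: linear closed)

lemma Cauchy_Schwarz:
  assumes "x \<in> M" "y \<in> M"
  shows "(cmod (\<theta> (star y * x)))\<^sup>2 \<le> Re (\<theta> (star x * x)) * Re (\<theta> (star y * y))"
proof (rule nonneg_form_Cauchy_Schwarz)
  show "\<theta> (star x * x) + c * \<theta> (star x * y) + cnj c * \<theta> (star y * x) + c * cnj c * \<theta> (star y * y)
    \<in> \<real>\<^sub>\<ge>\<^sub>0" for c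
    using positive[of "x + c *\<^sub>C y"] assms by (simp add: expand closed)
qed (use positive assms in auto)

end

lemma tracial_state_positive_functional:
  "star_subalgebra M \<Longrightarrow> \<theta> \<in> tracial_states M \<Longrightarrow> positive_functional M \<theta>"
  by (auto simp: positive_functional_def tracial_states_def positive_elements_def)

lemma tracial_statesD:
  assumes "\<theta> \<in> tracial_states M"
  shows "\<theta> \<in> functionals_on M" "\<theta> 1 = 1" "x \<in> M \<Longrightarrow> y \<in> M \<Longrightarrow> \<theta> (x * y) = \<theta> (y * x)"
    "x \<in> M \<Longrightarrow> \<theta> (star x * x) \<in> \<real>\<^sub>\<ge>\<^sub>0"
  using assms by (auto simp: tracial_states_def positive_elements_def)

text \<open>Polarization: the squares \<open>(1 + c y)\<^sup>* (1 + c y)\<close> for \<open>c = 1\<close> and \<open>c = \<i>\<close> determine the value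
  at \<open>y\<close>.\<close>

lemma functionals_eqI_star_squares:
  fixes \<theta> \<theta>' :: "'b::complex_star_algebra \<Rightarrow> complex"
  assumes \<theta>: "\<theta> \<in> functionals_on UNIV" and \<theta>': "\<theta>' \<in> functionals_on UNIV"
    and eq: "\<And>x. \<theta> (star x * x) = \<theta>' (star x * x)"
  shows "\<theta> = \<theta>'"
proof
  fix y
  have *: "c * \<theta> y + cnj c * \<theta> (star y) = c * \<theta>' y + cnj c * \<theta>' (star y)" for c
    using eq[of "1 + c *\<^sub>C y"] eq[of 1] eq[of y] \<theta> \<theta>'
    unfolding star_square_expand by (simp add: functionals_on_def)
  show "\<theta> y = \<theta>' y"
    using *[of 1] *[of \<i>] by (simp add: complex_eq_iff)
qed

text \<open>If \<open>\<alpha>\<close> were negative, the normalized functional would be a tracial state on the line through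
  \<open>\<phi>1\<close> and \<open>\<phi>2\<close> beyond \<open>\<phi>2\<close>, so that \<open>\<phi>2\<close> would lie between two tracial states.\<close>

lemma extreme_pair_coefficient_nonneg:
  fixes \<phi>1 \<phi>2 :: "'b::complex_star_algebra \<Rightarrow> complex"
  assumes ext: "\<phi>1 \<in> extreme_points (tracial_states UNIV)" "\<phi>2 \<in> extreme_points (tracial_states UNIV)"
    and ne: "\<phi>1 \<noteq> \<phi>2"
    and pos: "\<And>x. \<alpha> * \<phi>1 (star x * x) + \<beta> * \<phi>2 (star x * x) \<in> \<real>\<^sub>\<ge>\<^sub>0"
  shows "\<alpha> \<in> \<real>\<^sub>\<ge>\<^sub>0"
proof -
  have T: "\<phi>1 \<in> tracial_states UNIV" "\<phi>2 \<in> tracial_states UNIV"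
    using ext by (auto simp: extreme_points_def)
  note \<phi>1 = tracial_statesD[OF T(1)] and \<phi>2 = tracial_statesD[OF T(2)]
  define s where "s = Re (\<alpha> + \<beta>)"
  have "\<alpha> + \<beta> \<in> \<real>\<^sub>\<ge>\<^sub>0" using pos[of 1] \<phi>1(2) \<phi>2(2) by simp
  then have s: "\<alpha> + \<beta> = of_real s" "s \<ge> 0"
    by (auto simp: s_def complex_nonneg_Reals_iff complex_eq_iff)
  \<comment> \<open>A positive element on which the two states differ forces \<open>\<alpha>\<close> to be real.\<close>
  obtain x where x: "\<phi>1 (star x * x) \<noteq> \<phi>2 (star x * x)"
    using functionals_eqI_star_squares[OF \<phi>1(1) \<phi>2(1)] ne by blast
  have im: "Im (\<phi>1 (star x * x)) = 0" "Im (\<phi>2 (star x * x)) = 0"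
    using \<phi>1(4)[of x] \<phi>2(4)[of x] by (auto simp: complex_nonneg_Reals_iff)
  have im\<beta>: "Im \<beta> = - Im \<alpha>" using s(1) by (simp add: complex_eq_iff)
  have "Im (\<alpha> * \<phi>1 (star x * x) + \<beta> * \<phi>2 (star x * x)) = 0"
    using pos[of x] by (simp add: complex_nonneg_Reals_iff)
  then have "Im \<alpha> * (Re (\<phi>1 (star x * x)) - Re (\<phi>2 (star x * x))) = 0"
    by (simp add: im im\<beta> algebra_simps)
  moreover have "Re (\<phi>1 (star x * x)) \<noteq> Re (\<phi>2 (star x * x))"
    using x im by (auto simp: complex_eq_iff)
  ultimately have "Im \<alpha> = 0" by simp
  then obtain a where a: "\<alpha> = of_real a" by (metis complex_is_Real_iff Reals_cases)
  then have \<beta>: "\<beta> = of_real (s - a)" using s(1) by (simp add: algebra_simps)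
  have "a \<ge> 0"
  proof (rule ccontr)
    assume "\<not> a \<ge> 0"
    \<comment> \<open>Adding \<open>\<phi>2\<close> to the given functional makes the normalization possible also when \<open>s = 0\<close>. The
      weight \<open>t\<close> solves \<open>\<phi>2 = t \<tau> + (1 - t) \<phi>1\<close>.\<close>
    define \<tau> where "\<tau> x = (of_real a * \<phi>1 x + of_real (s - a + 1) * \<phi>2 x) / of_real (s + 1)" for x
    define t where "t = (s + 1) / (s + 1 - a)"
    have s1: "of_real (s + 1) \<noteq> (0::complex)" using s(2)
      unfolding of_real_eq_0_iff by linarith
    have "\<tau> \<in> tracial_states UNIV"
    proof -
      have "\<tau> \<in> functionals_on UNIV"
        using \<phi>1(1) \<phi>2(1) unfolding functionals_on_def \<tau>_def
        by (simp add: algebra_simps add_divide_distrib diff_divide_distrib)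
      moreover have "\<tau> 1 = 1" using s1 by (simp add: \<tau>_def \<phi>1(2) \<phi>2(2) add_ac)
      moreover have "\<tau> (x * y) = \<tau> (y * x)" for x y
        using \<phi>1(3)[of x y] \<phi>2(3)[of x y] by (simp add: \<tau>_def)
      moreover have "\<tau> (star x * x) \<in> \<real>\<^sub>\<ge>\<^sub>0" for x
      proof -
        have "of_real (s + 1) * \<tau> (star x * x) =
          (\<alpha> * \<phi>1 (star x * x) + \<beta> * \<phi>2 (star x * x)) + \<phi>2 (star x * x)"
          using s1 by (simp add: \<tau>_def a \<beta> field_simps)
        also have "\<dots> \<in> \<real>\<^sub>\<ge>\<^sub>0" by (intro nonneg_Reals_add_I pos \<phi>2(4)) simp
        finally have "of_real (s + 1) * \<tau> (star x * x) / of_real (s + 1) \<in> \<real>\<^sub>\<ge>\<^sub>0"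
          using s(2) by (intro nonneg_Reals_divide_I) auto
        then show ?thesis using s1 by simp
      qed
      ultimately show ?thesis by (auto simp: tracial_states_def positive_elements_def)
    qed
    moreover have "0 < t" "t < 1" using \<open>\<not> a \<ge> 0\<close> s(2) by (auto simp: t_def field_simps)
    moreover have "\<phi>2 x = of_real t * \<tau> x + of_real (1 - t) * \<phi>1 x" for x
    proof -
      have "of_real (s + 1 - a) \<noteq> (0::complex)" using \<open>\<not> a \<ge> 0\<close> s(2)
        unfolding of_real_eq_0_iff by linarith
      then have t: "of_real t = of_real (s + 1) / (of_real (s + 1 - a) :: complex)"
          "of_real (1 - t) = - of_real a / (of_real (s + 1 - a) :: complex)"
        by (auto simp: t_def field_simps)
      show ?thesis
        unfolding t \<tau>_def using s1 \<open>of_real (s + 1 - a) \<noteq> (0::complex)\<close>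
        by (simp add: divide_simps)
    qed
    ultimately have "\<phi>1 = \<phi>2"
      using ext(2) T(1) unfolding extreme_points_def by blast
    then show False using ne by contradiction
  qed
  then show ?thesis using a by simp
qed


section \<open>Normal extension of traces\<close>

locale gns_trace =
  fixes \<phi> :: "'a::complex_star_algebra \<Rightarrow> complex"
    and \<pi> :: "'a \<Rightarrow> 'h::complex_hilbert_space bounded_op" and \<xi> :: 'h
  assumes GNS: "GNS_representation \<phi> \<pi> \<xi>" and state: "\<phi> \<in> tracial_states UNIV"
begin

definition N :: "'h bounded_op set" where "N = weak_closure_of_range \<pi>"

definition vec :: "'a \<Rightarrow> 'h" where "vec a = apply_op (\<pi> a) \<xi>"

lemma rep [simp]: "\<pi> (a + b) = \<pi> a + \<pi> b" "\<pi> (c *\<^sub>C a) = c *\<^sub>C \<pi> a" "\<pi> (a * b) = \<pi> a * \<pi> b"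
    "\<pi> (star a) = star (\<pi> a)" "\<pi> 1 = 1"
  using GNS by (auto simp: GNS_representation_def unital_star_representation_def)

lemma rep_zero [simp]: "\<pi> 0 = 0"
  using rep(1)[of 0 0] by simp

lemma rep_sum: "\<pi> (\<Sum>i\<in>I. x i) = (\<Sum>i\<in>I. \<pi> (x i))"
  by (induction I rule: infinite_finite_induct) auto

lemma vec_add: "vec (a + b) = vec a + vec b" and vec_scaleC: "vec (c *\<^sub>C a) = c *\<^sub>C vec a"
  and apply_rep_vec: "apply_op (\<pi> a) (vec b) = vec (a * b)"
  by (simp_all add: vec_def)

lemma vec_sum: "vec (\<Sum>i\<in>I. x i) = (\<Sum>i\<in>I. vec (x i))"
  by (simp add: vec_def rep_sum apply_op_sum)

lemma dense_vec: "closure (range vec) = UNIV"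
  using GNS by (simp add: GNS_representation_def vec_def)

lemma cinner_vec: "cinner (vec a) (vec b) = \<phi> (star b * a)"
proof -
  have "\<phi> (star b * a) = cinner (apply_op (star (\<pi> b)) (apply_op (\<pi> a) \<xi>)) \<xi>"
    using GNS by (simp add: GNS_representation_def)
  then show ?thesis by (simp add: cinner_star_left vec_def)
qed

lemma \<phi>_eq_cinner: "\<phi> a = cinner (vec a) \<xi>"
  using GNS by (simp add: GNS_representation_def vec_def)

lemma norm_vec: "(norm (vec a))\<^sup>2 = Re (\<phi> (star a * a))"
  using cinner_self[of "vec a"] by (simp add: cinner_vec)

lemma cinner_\<xi> [simp]: "cinner \<xi> \<xi> = 1"
  using \<phi>_eq_cinner[of 1] tracial_statesD(2)[OF state] by (simp add: vec_def)

lemma norm_vec_star: "norm (vec (star a)) = norm (vec a)"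
proof -
  have "(norm (vec (star a)))\<^sup>2 = (norm (vec a))\<^sup>2"
    using tracial_statesD(3)[OF state, of a "star a"] by (simp add: norm_vec star_star)
  then show ?thesis by simp
qed

lemma eq_on_dense:
  assumes "bounded_linear f" "bounded_linear g" "\<And>a. f (vec a) = g (vec a)"
  shows "f v = g v"
proof -
  have "closed {v. f v = g v}"
    using assms(1,2) by (intro closed_Collect_eq linear_continuous_on)
  then have "closure (range vec) \<subseteq> {v. f v = g v}"
    using assms(3) by (intro closure_minimal) auto
  then show ?thesis using dense_vec by auto
qed

lemma op_eqI_vec: "(\<And>a. apply_op S (vec a) = apply_op T (vec a)) \<Longrightarrow> S = T"
  using eq_on_dense[OF bounded_linear_apply_op bounded_linear_apply_op] by (metis bounded_op_eqI)

lemma operator_of_bounded_map: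
  assumes "\<And>a b. f (a + b) = f a + f b" "\<And>c a. f (c *\<^sub>C a) = c *\<^sub>C f a"
    and "\<And>a. norm (f a) \<le> C * norm (vec a)"
  shows "\<exists>F. \<forall>a. apply_op F (vec a) = f a"
proof -
  have "\<exists>F. \<forall>(u, v)\<in>range (\<lambda>a. (vec a, f a)). apply_op F u = v"
  proof (rule bounded_graph_extends_to_operator)
    show "closure (fst ` range (\<lambda>a. (vec a, f a))) = UNIV"
      using dense_vec by (simp add: image_image)
  qed (use assms in \<open>force simp flip: vec_add vec_scaleC\<close>)+
  then show ?thesis by auto
qed

text \<open>Since the trace is invariant under the adjoint, right multiplication is conjugate to left
  multiplication.\<close>

lemma right_multiplication_operator: "\<exists>R. \<forall>a. apply_op R (vec a) = vec (a * b)"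
proof -
  obtain K where K: "\<And>v. norm (apply_op (\<pi> (star b)) v) \<le> K * norm v"
    using apply_op_bound by metis
  have "norm (vec (a * b)) \<le> K * norm (vec a)" for a
    using K[of "vec (star a)"] norm_vec_star[of "a * b"] norm_vec_star[of a]
    by (simp add: apply_rep_vec star_mult del: rep)
  then show ?thesis
    by (intro operator_of_bounded_map[where C = K])
      (simp_all add: distrib_right mult_scaleC_left vec_add vec_scaleC)
qed

lemma rep_in_N: "\<pi> a \<in> N"
  using closure_of_subset[of "range \<pi>" WOT] by (auto simp: N_def weak_closure_of_range_def)

lemma functional_eq_on_N:
  fixes f g :: "'h bounded_op \<Rightarrow> complex"
  assumes "continuous_map WOT euclidean f" "continuous_map WOT euclidean g"
    "\<And>a. f (\<pi> a) = g (\<pi> a)" "x \<in> N"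
  shows "f x = g x"
  using forall_in_closure_of_eq[of x WOT "range \<pi>" euclidean f g] assms
  by (auto simp: N_def weak_closure_of_range_def)

lemma eq_on_N:
  assumes "continuous_map WOT WOT f" "continuous_map WOT WOT g"
    "\<And>a. f (\<pi> a) = g (\<pi> a)" "x \<in> N"
  shows "f x = g x"
proof (rule bounded_op_eqI, rule cinner_eqI)
  fix v w
  have "cinner (apply_op (f x) v) w = cinner (apply_op (g x) v) w"
    by (rule functional_eq_on_N) (use assms in \<open>auto simp: continuous_map_into_WOT_iff\<close>)
  then show "cinner w (apply_op (f x) v) = cinner w (apply_op (g x) v)"
    by (metis cinner_commute)
qed

lemma maps_N_into_N:
  assumes "continuous_map WOT WOT f" "\<And>a. f (\<pi> a) \<in> N" "x \<in> N"
  shows "f x \<in> N"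
proof -
  have "f x \<in> WOT closure_of (f ` range \<pi>)"
    using continuous_map_image_closure_subset[OF assms(1), of "range \<pi>"] assms(3)
    by (auto simp: N_def weak_closure_of_range_def)
  also have "\<dots> \<subseteq> WOT closure_of N"
    using assms(2) by (intro closure_of_mono) auto
  also have "\<dots> = N" by (simp add: N_def weak_closure_of_range_def)
  finally show ?thesis .
qed

lemma star_subalgebra_N: "star_subalgebra N"
proof -
  have add: "x + y \<in> N" and mult: "x * y \<in> N" if "x \<in> N" "y \<in> N" for x y
  proof -
    have 1: "\<pi> a + y \<in> N" "\<pi> a * y \<in> N" for a
      by (rule maps_N_into_N[OF _ _ \<open>y \<in> N\<close>]; auto intro!: WOT_intros rep_in_N simp flip: rep)+
    show "x + y \<in> N" "x * y \<in> N"
      by (rule maps_N_into_N[OF _ _ \<open>x \<in> N\<close>]; auto intro!: WOT_intros 1)+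
  qed
  moreover have "star x \<in> N" "c *\<^sub>C x \<in> N" if "x \<in> N" for x c
    by (rule maps_N_into_N[OF _ _ that]; auto intro!: WOT_intros rep_in_N simp flip: rep)+
  moreover have "1 \<in> N" using rep_in_N[of 1] by simp
  ultimately show ?thesis by (simp add: star_subalgebra_def)
qed

lemma N_closed: "1 \<in> N" "x \<in> N \<Longrightarrow> y \<in> N \<Longrightarrow> x + y \<in> N" "x \<in> N \<Longrightarrow> y \<in> N \<Longrightarrow> x * y \<in> N"
    "x \<in> N \<Longrightarrow> c *\<^sub>C x \<in> N" "x \<in> N \<Longrightarrow> star x \<in> N"
  using star_subalgebra_N by (auto simp: star_subalgebra_def)

lemma N_sum: "(\<And>i. i \<in> I \<Longrightarrow> x i \<in> N) \<Longrightarrow> (\<Sum>i\<in>I. x i) \<in> N"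
  using rep_in_N[of 0] by (induction I rule: infinite_finite_induct) (auto intro: N_closed)

text \<open>The functional is cut off outside \<open>N\<close>, as functionals on a subalgebra vanish outside it.\<close>

definition vector_functional :: "'h \<Rightarrow> 'h bounded_op \<Rightarrow> complex" where
  "vector_functional \<eta> x = (if x \<in> N then cinner (apply_op x \<xi>) \<eta> else 0)"

lemma vector_functional_on_N: "x \<in> N \<Longrightarrow> vector_functional \<eta> x = cinner (apply_op x \<xi>) \<eta>"
  by (simp add: vector_functional_def)

lemma vector_functional_linear: "vector_functional \<eta> \<in> functionals_on N"
  by (auto simp: functionals_on_def vector_functional_def N_closed cinner_add_left cinner_scaleC_left)

lemma vector_functional_trace:
  assumes trace: "\<And>a b. cinner (vec (a * b)) \<eta> = cinner (vec (b * a)) \<eta>" and "x \<in> N" "y \<in> N"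
  shows "cinner (apply_op (x * y) \<xi>) \<eta> = cinner (apply_op (y * x) \<xi>) \<eta>"
proof (rule functional_eq_on_N[OF _ _ _ \<open>x \<in> N\<close>])
  fix a
  show "cinner (apply_op (\<pi> a * y) \<xi>) \<eta> = cinner (apply_op (y * \<pi> a) \<xi>) \<eta>"
  proof (rule functional_eq_on_N[OF _ _ _ \<open>y \<in> N\<close>])
    show "cinner (apply_op (\<pi> a * \<pi> b) \<xi>) \<eta> = cinner (apply_op (\<pi> b * \<pi> a) \<xi>) \<eta>" for b
      using trace[of a b] by (simp add: vec_def)
  qed (rule continuous_map_WOT_functional; intro WOT_intros)+
qed (rule continuous_map_WOT_functional; intro WOT_intros)+

text \<open>The operator \<open>h\<close> is the Radon-Nikodym derivative of the trace \<open>\<mu>\<close> with respect to \<open>\<phi>\<close>: by the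
  Cauchy-Schwarz inequality, \<open>\<mu> (b\<^sup>* a)\<close> is a bounded sesquilinear form in the GNS vectors of \<open>a\<close>
  and \<open>b\<close>. Membership of \<open>h\<close> in the commutant is what makes the extension of \<open>\<mu>\<close> to \<open>N\<close>
  positive.\<close>

lemma dominated_trace_derivative:
  assumes \<mu>: "\<mu> \<in> tracial_states UNIV"
    and dom: "\<And>a. Re (\<mu> (star a * a)) \<le> C * Re (\<phi> (star a * a))"
  obtains h where "\<And>a. \<mu> a = cinner (vec a) (apply_op h \<xi>)"
    and "\<And>x. x \<in> N \<Longrightarrow> apply_op h (apply_op x \<xi>) = apply_op x (apply_op h \<xi>)"
    and "\<And>v. cinner v (apply_op h v) \<in> \<real>\<^sub>\<ge>\<^sub>0"
proof -
  interpret \<mu>: positive_functional UNIV \<mu>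
    using \<mu> by (intro tracial_state_positive_functional) auto
  have dom': "Re (\<mu> (star a * a)) \<le> (\<bar>C\<bar> + 1) * (norm (vec a))\<^sup>2" for a
  proof -
    have "C * (norm (vec a))\<^sup>2 \<le> (\<bar>C\<bar> + 1) * (norm (vec a))\<^sup>2" by (intro mult_right_mono) auto
    then show ?thesis using dom[of a] by (simp add: norm_vec)
  qed
  have bound: "cmod (\<mu> (star b * a)) \<le> (\<bar>C\<bar> + 1) * (norm (vec a) * norm (vec b))" for a b
  proof (rule power2_le_imp_le)
    have "(cmod (\<mu> (star b * a)))\<^sup>2 \<le> Re (\<mu> (star a * a)) * Re (\<mu> (star b * b))"
      by (rule \<mu>.Cauchy_Schwarz) auto
    also have "\<dots> \<le> ((\<bar>C\<bar> + 1) * (norm (vec a))\<^sup>2) * ((\<bar>C\<bar> + 1) * (norm (vec b))\<^sup>2)"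
      by (intro mult_mono dom' \<mu>.Re_star_square_nonneg) auto
    also have "\<dots> = ((\<bar>C\<bar> + 1) * (norm (vec a) * norm (vec b)))\<^sup>2"
      by (simp add: power2_eq_square)
    finally show "(cmod (\<mu> (star b * a)))\<^sup>2 \<le> ((\<bar>C\<bar> + 1) * (norm (vec a) * norm (vec b)))\<^sup>2" .
  qed auto
  \<comment> \<open>A bounded functional on a dense subspace is represented by a vector: multiply it by the unit
    vector \<open>\<xi>\<close> and apply the adjoint of the resulting operator to \<open>\<xi>\<close>.\<close>
  have "\<exists>F. \<forall>a. apply_op F (vec a) = \<mu> a *\<^sub>C \<xi>"
  proof (rule operator_of_bounded_map)
    show "norm (\<mu> a *\<^sub>C \<xi>) \<le> ((\<bar>C\<bar> + 1) * (norm \<xi> * norm \<xi>)) * norm (vec a)" for a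
    proof -
      have "cmod (\<mu> a) * norm \<xi> \<le> ((\<bar>C\<bar> + 1) * (norm (vec a) * norm \<xi>)) * norm \<xi>"
        using bound[of 1 a] by (intro mult_right_mono) (auto simp: vec_def)
      then show ?thesis by (simp add: norm_scaleC_hilbert mult_ac)
    qed
  qed (simp_all add: \<mu>.linear scaleC_add_left scaleC_scaleC)
  then obtain F where F: "\<And>a. apply_op F (vec a) = \<mu> a *\<^sub>C \<xi>" by blast
  define \<eta> where "\<eta> = apply_op (star F) \<xi>"
  have \<eta>: "\<mu> a = cinner (vec a) \<eta>" for a
    using cinner_star_op[of F "vec a" \<xi>] by (simp add: F \<eta>_def cinner_scaleC_left)
  have \<mu>_eq: "\<mu> (star b * a) = cinner (vec a) (apply_op (\<pi> b) \<eta>)" for a b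
    by (simp add: \<eta> cinner_star_left flip: apply_rep_vec)
  have "\<exists>h. \<forall>b. apply_op h (vec b) = apply_op (\<pi> b) \<eta>"
  proof (rule operator_of_bounded_map)
    fix b
    let ?v = "apply_op (\<pi> b) \<eta>"
    have "?v \<in> closure (range vec)" using dense_vec by simp
    then obtain u where u: "\<And>n. u n \<in> range vec" "u \<longlonglongrightarrow> ?v"
      unfolding closure_sequential by blast
    have "cmod (cinner (u n) ?v) \<le> (\<bar>C\<bar> + 1) * (norm (u n) * norm (vec b))" for n
      using u(1)[of n] bound[of b] by (auto simp: \<mu>_eq)
    then have "cmod (cinner ?v ?v) \<le> (\<bar>C\<bar> + 1) * (norm ?v * norm (vec b))"
      by (intro LIMSEQ_le[OF tendsto_norm[OF bounded_linear.tendsto[OF bounded_linear_cinner_left u(2)]]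
            tendsto_mult[OF tendsto_const tendsto_mult[OF tendsto_norm[OF u(2)] tendsto_const]]]) auto
    then have "norm ?v * norm ?v \<le> norm ?v * ((\<bar>C\<bar> + 1) * norm (vec b))"
      by (simp add: cinner_self norm_mult power2_eq_square mult_ac)
    then show "norm ?v \<le> (\<bar>C\<bar> + 1) * norm (vec b)"
      by (cases "?v = 0") auto
  qed auto
  then obtain h where h: "\<And>b. apply_op h (vec b) = apply_op (\<pi> b) \<eta>" by blast
  have h\<xi>: "apply_op h \<xi> = \<eta>" using h[of 1] by (simp add: vec_def)
  show ?thesis
  proof (rule that)
    show "\<mu> a = cinner (vec a) (apply_op h \<xi>)" for a by (simp add: \<eta> h\<xi>)
    show "apply_op h (apply_op x \<xi>) = apply_op x (apply_op h \<xi>)" if "x \<in> N" for x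
    proof -
      have "h * \<pi> a = \<pi> a * h" for a
        by (rule op_eqI_vec) (simp add: apply_rep_vec h)
      then have "h * x = x * h"
        using eq_on_N[OF _ _ _ that, of "\<lambda>x. h * x" "\<lambda>x. x * h"] by (simp add: WOT_intros)
      then show ?thesis by (metis times_bounded_op.rep_eq)
    qed
    fix v
    have "v \<in> closure (range vec)" using dense_vec by simp
    then obtain u where u: "\<And>n. u n \<in> range vec" "u \<longlonglongrightarrow> v"
      unfolding closure_sequential by blast
    have pos: "cinner (u n) (apply_op h (u n)) \<in> \<real>\<^sub>\<ge>\<^sub>0" for n
      using u(1)[of n] \<mu>.positive by (auto simp: h simp flip: \<mu>_eq)
    have lim: "(\<lambda>n. cinner (u n) (apply_op h (u n))) \<longlonglongrightarrow> cinner v (apply_op h v)"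
    proof -
      have hu: "(\<lambda>n. apply_op h (u n)) \<longlonglongrightarrow> apply_op h v"
        by (rule bounded_linear.tendsto[OF bounded_linear_apply_op u(2)])
      have iu: "(\<lambda>n. \<i> *\<^sub>C u n) \<longlonglongrightarrow> \<i> *\<^sub>C v"
        by (rule bounded_linear.tendsto[OF bounded_linear_scaleC u(2)])
      show ?thesis
        unfolding tendsto_complex_iff Re_cinner Im_cinner
        by (intro conjI tendsto_intros tendsto_inner hu iu u(2))
    qed
    show "cinner v (apply_op h v) \<in> \<real>\<^sub>\<ge>\<^sub>0"
      by (rule closed_sequentially[OF closed_nonneg_Reals_complex _ lim]) (rule pos)
  qed
qed

text \<open>A positive functional below a multiple of the normal functional \<open>x \<mapsto> \<langle>x \<xi>, \<xi>\<rangle>\<close> is itself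
  normal: the Cauchy-Schwarz inequality bounds it by the norm of \<open>x \<xi>\<close>.\<close>

lemma dominated_functional_is_vector_functional:
  assumes \<theta>: "positive_functional N \<theta>"
    and dom: "\<And>x. x \<in> N \<Longrightarrow> Re (\<theta> (star x * x)) \<le> C * (norm (apply_op x \<xi>))\<^sup>2"
  shows "\<exists>\<eta>. \<theta> = vector_functional \<eta>"
proof -
  interpret \<theta>: positive_functional N \<theta> by fact
  define K where "K = \<bar>C\<bar> * Re (\<theta> 1)"
  have "0 \<le> Re (\<theta> 1)" using \<theta>.Re_star_square_nonneg[of 1] by (simp add: N_closed)
  then have "K \<ge> 0" by (simp add: K_def)
  have bound: "cmod (\<theta> x) \<le> sqrt K * norm (apply_op x \<xi>)" if "x \<in> N" for x
  proof -
    have "(cmod (\<theta> x))\<^sup>2 \<le> Re (\<theta> (star x * x)) * Re (\<theta> 1)"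
      using \<theta>.Cauchy_Schwarz[OF that N_closed(1)] by simp
    also have "\<dots> \<le> (\<bar>C\<bar> * (norm (apply_op x \<xi>))\<^sup>2) * Re (\<theta> 1)"
    proof (intro mult_right_mono)
      have "C * (norm (apply_op x \<xi>))\<^sup>2 \<le> \<bar>C\<bar> * (norm (apply_op x \<xi>))\<^sup>2"
        by (intro mult_right_mono) auto
      then show "Re (\<theta> (star x * x)) \<le> \<bar>C\<bar> * (norm (apply_op x \<xi>))\<^sup>2"
        using dom[OF that] by linarith
    qed fact
    also have "\<dots> = (sqrt K * norm (apply_op x \<xi>))\<^sup>2"
      using \<open>K \<ge> 0\<close> by (simp add: power_mult_distrib K_def mult_ac)
    finally show ?thesis
      by (rule power2_le_imp_le) (use \<open>K \<ge> 0\<close> in auto)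
  qed
  define V where "V = (\<lambda>x. (apply_op x \<xi>, \<theta> x *\<^sub>C \<xi>)) ` N"
  have "\<exists>F. \<forall>(u, v)\<in>V. apply_op F u = v"
  proof (rule bounded_graph_extends_to_operator)
    have "range vec \<subseteq> fst ` V" using rep_in_N by (auto simp: V_def image_image vec_def)
    then have "closure (range vec) \<subseteq> closure (fst ` V)" by (rule closure_mono)
    then show "closure (fst ` V) = UNIV" using dense_vec by auto
    fix u v assume uv: "(u, v) \<in> V"
    then obtain x where x: "x \<in> N" "u = apply_op x \<xi>" "v = \<theta> x *\<^sub>C \<xi>" by (auto simp: V_def)
    show "norm v \<le> (sqrt K * norm \<xi>) * norm u"
      using mult_right_mono[OF bound[OF x(1)], of "norm \<xi>"]
      by (simp add: x norm_scaleC_hilbert mult_ac)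
    show "(c *\<^sub>C u, c *\<^sub>C v) \<in> V" for c
      unfolding V_def using x
      by (intro image_eqI[of _ _ "c *\<^sub>C x"]) (auto simp: N_closed \<theta>.linear scaleC_scaleC)
    fix u' v' assume "(u', v') \<in> V"
    then obtain y where y: "y \<in> N" "u' = apply_op y \<xi>" "v' = \<theta> y *\<^sub>C \<xi>" by (auto simp: V_def)
    show "(u + u', v + v') \<in> V"
      unfolding V_def using x y
      by (intro image_eqI[of _ _ "x + y"]) (auto simp: N_closed \<theta>.linear scaleC_add_left)
  qed
  then obtain F where F: "\<And>x. x \<in> N \<Longrightarrow> apply_op F (apply_op x \<xi>) = \<theta> x *\<^sub>C \<xi>"
    by (auto simp: V_def)
  have "\<theta> x = vector_functional (apply_op (star F) \<xi>) x" for x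
  proof (cases "x \<in> N")
    case True
    then show ?thesis using cinner_star_op[of F "apply_op x \<xi>" \<xi>]
      by (simp add: F cinner_scaleC_left vector_functional_on_N)
  next
    case False
    then show ?thesis using \<theta>.functional by (simp add: functionals_on_def vector_functional_def)
  qed
  then show ?thesis by blast
qed

lemma restricted_tracial_state:
  assumes "\<theta> \<in> tracial_states N"
  shows "\<theta> \<circ> \<pi> \<in> tracial_states UNIV"
proof -
  note \<theta> = tracial_statesD[OF assms]
  have "\<theta> \<circ> \<pi> \<in> functionals_on UNIV"
    using \<theta>(1) rep_in_N by (simp add: functionals_on_def)
  moreover have "\<theta> (star (\<pi> a) * \<pi> a) \<in> \<real>\<^sub>\<ge>\<^sub>0" "\<theta> (\<pi> a * \<pi> b) = \<theta> (\<pi> b * \<pi> a)" for a b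
    using \<theta>(3,4) rep_in_N by auto
  ultimately show ?thesis
    using \<theta>(2) by (auto simp: tracial_states_def positive_elements_def)
qed

text \<open>A tracial state in a convex decomposition of the normal extension is dominated by it, hence
  normal, hence determined by its restriction to \<open>\<pi>(A)\<close>; so extremality is inherited.\<close>

lemma extreme_trace_extends:
  assumes \<mu>: "\<mu> \<in> extreme_points (tracial_states UNIV)"
    and dom: "\<And>a. Re (\<mu> (star a * a)) \<le> C * Re (\<phi> (star a * a))"
  obtains \<eta> where "vector_functional \<eta> \<in> extreme_points (tracial_states N)"
    and "vector_functional \<eta> \<circ> \<pi> = \<mu>"
proof -
  have \<mu>T: "\<mu> \<in> tracial_states UNIV" using \<mu> by (simp add: extreme_points_def)
  obtain h where h: "\<And>a. \<mu> a = cinner (vec a) (apply_op h \<xi>)"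
    "\<And>x. x \<in> N \<Longrightarrow> apply_op h (apply_op x \<xi>) = apply_op x (apply_op h \<xi>)"
    "\<And>v. cinner v (apply_op h v) \<in> \<real>\<^sub>\<ge>\<^sub>0"
    using dominated_trace_derivative[OF \<mu>T dom] by metis
  define \<eta> where "\<eta> = apply_op h \<xi>"
  let ?\<mu> = "vector_functional \<eta>"
  have comp: "?\<mu> \<circ> \<pi> = \<mu>"
    by (rule ext) (simp add: vector_functional_on_N rep_in_N h(1) \<eta>_def vec_def)
  have square: "?\<mu> (star x * x) = cinner (apply_op x \<xi>) (apply_op h (apply_op x \<xi>))" if "x \<in> N" for x
    using that by (simp add: vector_functional_on_N N_closed cinner_star_left h(2) \<eta>_def)
  have state: "?\<mu> \<in> tracial_states N"
  proof -
    have "?\<mu> a \<in> \<real>\<^sub>\<ge>\<^sub>0" if "a \<in> positive_elements N" for a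
      using that h(3) by (auto simp: positive_elements_def square)
    moreover have "?\<mu> 1 = 1"
      using fun_cong[OF comp, of 1] tracial_statesD(2)[OF \<mu>T] by simp
    moreover have "?\<mu> (x * y) = ?\<mu> (y * x)" if "x \<in> N" "y \<in> N" for x y
    proof -
      have "cinner (vec (a * b)) \<eta> = cinner (vec (b * a)) \<eta>" for a b
        using tracial_statesD(3)[OF \<mu>T, of a b] by (simp add: h(1) \<eta>_def)
      from vector_functional_trace[OF this that] show ?thesis
        using that by (simp only: vector_functional_on_N N_closed)
    qed
    ultimately show ?thesis by (simp add: tracial_states_def vector_functional_linear)
  qed
  have component: "\<tau> = ?\<mu>"
    if \<tau>: "\<tau> \<in> tracial_states N" "\<tau> \<circ> \<pi> = \<mu>" and \<tau>': "\<tau>' \<in> tracial_states N" and t: "0 < t" "t < 1"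
      and eq: "\<And>x. ?\<mu> x = of_real t * \<tau> x + of_real (1 - t) * \<tau>' x" for \<tau> \<tau>' and t :: real
  proof -
    obtain K where K: "K > 0" "\<And>v. norm (apply_op h v) \<le> K * norm v"
      using apply_op_bound by blast
    have "Re (\<tau> (star x * x)) \<le> (K / t) * (norm (apply_op x \<xi>))\<^sup>2" if "x \<in> N" for x
    proof -
      let ?v = "apply_op x \<xi>"
      have "0 \<le> Re (\<tau>' (star x * x))"
        using tracial_statesD(4)[OF \<tau>' that] by (simp add: complex_nonneg_Reals_iff)
      then have "t * Re (\<tau> (star x * x)) \<le> Re (?\<mu> (star x * x))"
        using t(2) by (simp add: eq)
      also have "\<dots> \<le> cmod (cinner ?v (apply_op h ?v))"
        using square[OF that] complex_Re_le_cmod by simp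
      also have "\<dots> \<le> norm ?v * norm (apply_op h ?v)" by (rule norm_cinner_le)
      also have "\<dots> \<le> norm ?v * (K * norm ?v)" by (intro mult_left_mono K) auto
      finally show ?thesis using t(1) by (simp add: field_simps power2_eq_square)
    qed
    then obtain \<eta>' where \<eta>': "\<tau> = vector_functional \<eta>'"
      using dominated_functional_is_vector_functional[OF
          tracial_state_positive_functional[OF star_subalgebra_N \<tau>(1)]] by blast
    have "\<tau> x = ?\<mu> x" if "x \<in> N" for x
    proof -
      have "cinner (apply_op x \<xi>) \<eta>' = cinner (apply_op x \<xi>) \<eta>"
      proof (rule functional_eq_on_N[OF _ _ _ that])
        fix a
        show "cinner (apply_op (\<pi> a) \<xi>) \<eta>' = cinner (apply_op (\<pi> a) \<xi>) \<eta>"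
          using fun_cong[OF \<tau>(2), of a] fun_cong[OF comp, of a]
          by (simp add: \<eta>' vector_functional_on_N rep_in_N)
      qed (rule continuous_map_WOT_coefficient)+
      then show ?thesis using that by (simp add: \<eta>' vector_functional_on_N)
    qed
    then show ?thesis by (auto simp: \<eta>' vector_functional_def)
  qed
  have "?\<mu> \<in> extreme_points (tracial_states N)"
    unfolding extreme_points_def
  proof (clarsimp simp: state)
    fix \<tau>1 \<tau>2 and t :: real
    assume \<tau>: "\<tau>1 \<in> tracial_states N" "\<tau>2 \<in> tracial_states N" and t: "0 < t" "t < 1"
      and eq: "\<forall>x. ?\<mu> x = of_real t * \<tau>1 x + (1 - of_real t) * \<tau>2 x"
    have "\<mu> a = of_real t * (\<tau>1 \<circ> \<pi>) a + of_real (1 - t) * (\<tau>2 \<circ> \<pi>) a" for a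
      using eq[rule_format, of "\<pi> a"] fun_cong[OF comp, of a] by simp
    then have "\<tau>1 \<circ> \<pi> = \<mu> \<and> \<tau>2 \<circ> \<pi> = \<mu>"
      using \<mu> \<tau>[THEN restricted_tracial_state] t unfolding extreme_points_def by blast
    then have r: "\<tau>1 \<circ> \<pi> = \<mu>" "\<tau>2 \<circ> \<pi> = \<mu>" by auto
    have eq1: "?\<mu> x = of_real t * \<tau>1 x + of_real (1 - t) * \<tau>2 x" for x
      using eq by (metis of_real_1 of_real_diff)
    have eq2: "?\<mu> x = of_real (1 - t) * \<tau>2 x + of_real (1 - (1 - t)) * \<tau>1 x" for x
      unfolding eq1 by simp
    have "\<tau>1 = ?\<mu>" by (rule component[OF \<tau>(1) r(1) \<tau>(2) t eq1])
    moreover have "\<tau>2 = ?\<mu>" by (rule component[OF \<tau>(2) r(2) \<tau>(1) _ _ eq2]) (use t in auto)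
    ultimately show "\<tau>1 = ?\<mu> \<and> \<tau>2 = ?\<mu>" ..
  qed
  then show ?thesis using comp that by blast
qed

end


section \<open>Full corners of matrix algebras\<close>

lemma sum_in_nonneg_Reals:
  "(\<And>i. i \<in> I \<Longrightarrow> x i \<in> \<real>\<^sub>\<ge>\<^sub>0) \<Longrightarrow> (\<Sum>i\<in>I. x i) \<in> \<real>\<^sub>\<ge>\<^sub>0"
  by (induction I rule: infinite_finite_induct) auto

text \<open>A right inverse of \<open>w\<close> near \<open>1\<close> is the fixed point of the contraction
  \<open>y \<mapsto> 1 + (1 - w) y\<close>.\<close>

lemma right_inverse_near_one:
  fixes w :: "'a::{real_normed_algebra, banach, monoid_mult}"
  assumes "norm (1 - w) < 1"
  shows "\<exists>y. w * y = 1"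
proof -
  have "\<exists>!y. 1 + (1 - w) * y = y"
  proof (rule banach_fix_type)
    show "\<forall>x y. dist (1 + (1 - w) * x) (1 + (1 - w) * y) \<le> norm (1 - w) * dist x y"
      by (simp add: dist_norm norm_mult_ineq flip: right_diff_distrib)
  qed (use assms in auto)
  then obtain y where "1 + (1 - w) * y = y" by blast
  then have "w * y = 1" by (simp add: left_diff_distrib)
  then show ?thesis ..
qed

lemma index_mult_mat_sum:
  assumes "A \<in> carrier_mat k k" "B \<in> carrier_mat k k" "i < k" "j < k"
  shows "(A * B) $$ (i, j) = (\<Sum>t<k. A $$ (i, t) * B $$ (t, j))"
  using assms by (simp add: scalar_prod_def atLeast0LessThan)

text \<open>The matrices with entries in the closure of the ideal \<open>J\<close> generated by the entries of \<open>p\<close> form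
  a closed ideal that contains \<open>p\<close>. By fullness, \<open>1\<close> is in the closure of \<open>J\<close>; then \<open>J\<close> contains a
  right invertible element, and hence \<open>1\<close>.\<close>

lemma full_matrix_generates_one:
  fixes p :: "'a::unital_cstar_algebra mat"
  assumes full: "full_mat k p" and p: "p \<in> carrier_mat k k" and k: "0 < k"
  shows "\<exists>(n :: nat) u t a b. (\<forall>m<n. u m < k \<and> t m < k) \<and>
    (\<Sum>m<n. a m * p $$ (u m, t m) * b m) = 1"
proof -
  let ?val = "\<lambda>l. sum_list (map (\<lambda>(a, u, t, b). a * p $$ (u, t) * b) l)"
  define J where "J = {?val l | l. \<forall>(a, u, t, b)\<in>set l. u < k \<and> t < k}"
  have J_zero: "0 \<in> J" unfolding J_def by (auto intro: exI[of _ "[]"])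
  have J_add: "x + y \<in> J" if xy: "x \<in> J" "y \<in> J" for x y
  proof -
    obtain l l' where l: "x = ?val l" "\<forall>(a, u, t, b)\<in>set l. u < k \<and> t < k"
      and l': "y = ?val l'" "\<forall>(a, u, t, b)\<in>set l'. u < k \<and> t < k"
      using xy by (auto simp: J_def)
    then show ?thesis unfolding J_def by (auto intro!: exI[of _ "l @ l'"])
  qed
  have J_mult: "c * x \<in> J" "x * c \<in> J" if x: "x \<in> J" for c x
  proof -
    obtain l where l: "x = ?val l" "\<forall>(a, u, t, b)\<in>set l. u < k \<and> t < k"
      using x by (auto simp: J_def)
    have "c * ?val l = ?val (map (\<lambda>(a, u, t, b). (c * a, u, t, b)) l)"
      by (induction l) (auto simp: distrib_left mult.assoc)
    then show "c * x \<in> J" unfolding J_def using l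
      by (auto intro!: exI[of _ "map (\<lambda>(a, u, t, b). (c * a, u, t, b)) l"])
    have "?val l * c = ?val (map (\<lambda>(a, u, t, b). (a, u, t, b * c)) l)"
      by (induction l) (auto simp: distrib_right mult.assoc)
    then show "x * c \<in> J" unfolding J_def using l
      by (auto intro!: exI[of _ "map (\<lambda>(a, u, t, b). (a, u, t, b * c)) l"])
  qed
  have J_entry: "p $$ (i, j) \<in> J" if "i < k" "j < k" for i j
    unfolding J_def using that by (auto intro!: exI[of _ "[(1, i, j, 1)]"])
  have cl_zero: "0 \<in> closure J" using J_zero closure_subset by blast
  have cl_add: "x + y \<in> closure J" if xy: "x \<in> closure J" "y \<in> closure J" for x y
  proof -
    obtain X Y where "\<And>n. X n \<in> J" "X \<longlonglongrightarrow> x" "\<And>n. Y n \<in> J" "Y \<longlonglongrightarrow> y"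
      using xy unfolding closure_sequential by blast
    then show ?thesis unfolding closure_sequential
      by (intro exI[of _ "\<lambda>n. X n + Y n"]) (auto intro: J_add tendsto_add)
  qed
  have cl_mult: "c * x \<in> closure J" "x * c \<in> closure J" if x: "x \<in> closure J" for c x
  proof -
    obtain X where X: "\<And>n. X n \<in> J" "X \<longlonglongrightarrow> x"
      using x unfolding closure_sequential by blast
    show "c * x \<in> closure J" unfolding closure_sequential
      using X by (intro exI[of _ "\<lambda>n. c * X n"]) (auto intro: J_mult tendsto_mult_left)
    show "x * c \<in> closure J" unfolding closure_sequential
      using X by (intro exI[of _ "\<lambda>n. X n * c"]) (auto intro: J_mult tendsto_mult_right)
  qed
  have cl_sum: "(\<Sum>i\<in>S. x i) \<in> closure J" if "\<And>i. i \<in> S \<Longrightarrow> x i \<in> closure J" for S :: "nat set" and x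
    using that by (induction S rule: infinite_finite_induct) (auto intro: cl_zero cl_add)
  define I where "I = {X \<in> carrier_mat k k. \<forall>i<k. \<forall>j<k. X $$ (i, j) \<in> closure J}"
  have "closed_mat_ideal k I"
    unfolding closed_mat_ideal_def
  proof (intro conjI ballI allI impI)
    show "I \<subseteq> carrier_mat k k" by (auto simp: I_def)
    show "0\<^sub>m k k \<in> I" using cl_zero by (auto simp: I_def)
    show "X + Y \<in> I" if "X \<in> I" "Y \<in> I" for X Y
      using that by (auto simp: I_def intro!: cl_add)
    show "scaleC_mat c X \<in> I" if X: "X \<in> I" for c X
    proof -
      have "c *\<^sub>C x \<in> closure J" if "x \<in> closure J" for x
        using cl_mult(1)[OF that, of "c *\<^sub>C 1"] by (simp add: mult_scaleC_left)
      then show ?thesis using X by (auto simp: I_def scaleC_mat_def)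
    qed
    show "X * Y \<in> I" if "X \<in> I" "Y \<in> carrier_mat k k" for X Y
      using that by (auto simp: I_def index_mult_mat_sum simp del: index_mult_mat(1)
          intro!: cl_sum cl_mult(2))
    show "Y * X \<in> I" if "X \<in> I" "Y \<in> carrier_mat k k" for X Y
      using that by (auto simp: I_def index_mult_mat_sum simp del: index_mult_mat(1)
          intro!: cl_sum cl_mult(1))
    fix X L
    assume *: "(\<forall>n. X n \<in> I) \<and> L \<in> carrier_mat k k \<and>
      (\<forall>i<k. \<forall>j<k. (\<lambda>n. X n $$ (i, j)) \<longlonglongrightarrow> L $$ (i, j))"
    have "L $$ (i, j) \<in> closure J" if "i < k" "j < k" for i j
      by (rule closed_sequentially[OF closed_closure, of "\<lambda>n. X n $$ (i, j)"])
        (use * that in \<open>auto simp: I_def\<close>)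
    then show "L \<in> I" using * by (simp add: I_def)
  qed
  moreover have "p \<in> I"
    using p J_entry closure_subset[of J] by (auto simp: I_def)
  ultimately have "carrier_mat k k \<subseteq> I" using full unfolding full_mat_def by blast
  then have "1\<^sub>m k \<in> I" by auto
  then have "1\<^sub>m k $$ (0, 0) \<in> closure J" using k unfolding I_def by blast
  then have "1 \<in> closure J" using k by simp
  then obtain w where w: "w \<in> J" "dist w 1 < 1"
    using closure_approachable[of 1 J] by (auto dest: spec[of _ "1 :: real"])
  then obtain y where "w * y = 1"
    using right_inverse_near_one[of w] by (auto simp: dist_norm norm_minus_commute)
  then have "1 \<in> J" using J_mult(2)[OF w(1), of y] by simp
  then obtain l where l: "?val l = 1" "\<forall>(a, u, t, b)\<in>set l. u < k \<and> t < k"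
    by (auto simp: J_def)
  have ut: "\<forall>m<length l. fst (snd (l ! m)) < k \<and> fst (snd (snd (l ! m))) < k"
    using l(2) nth_mem by (fastforce simp: case_prod_beta)
  have sum: "(\<Sum>m<length l. fst (l ! m) * p $$ (fst (snd (l ! m)), fst (snd (snd (l ! m)))) *
      snd (snd (snd (l ! m)))) = 1"
    using l(1) by (simp add: sum_list_sum_nth atLeast0LessThan case_prod_beta)
  show ?thesis
    by (rule exI[of _ "length l"], rule exI[of _ "\<lambda>m. fst (snd (l ! m))"],
        rule exI[of _ "\<lambda>m. fst (snd (snd (l ! m)))"], rule exI[of _ "\<lambda>m. fst (l ! m)"],
        rule exI[of _ "\<lambda>m. snd (snd (snd (l ! m)))"], rule conjI[OF ut sum])
qed

text \<open>An isomorphism \<open>\<Phi>\<close> onto the corner of a full projection \<open>P\<close> in terms of matrix entries: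
  \<open>f i j x\<close> is the entry of \<open>\<Phi> x\<close>, and \<open>g s v x\<close> is the preimage of \<open>P E P\<close>, where the matrix \<open>E\<close>
  has the single nonzero entry \<open>x\<close> in position \<open>(s, v)\<close>. Fullness enters as the decomposition of \<open>1\<close>.\<close>

locale full_corner_entries =
  fixes k :: nat and P :: "nat \<Rightarrow> nat \<Rightarrow> 'a::complex_star_algebra"
    and f :: "nat \<Rightarrow> nat \<Rightarrow> 'a \<Rightarrow> 'a" and g :: "nat \<Rightarrow> nat \<Rightarrow> 'a \<Rightarrow> 'a"
    and n :: nat and a b :: "nat \<Rightarrow> 'a" and u t :: "nat \<Rightarrow> nat"
  assumes f_add: "i < k \<Longrightarrow> j < k \<Longrightarrow> f i j (x + y) = f i j x + f i j y"
    and f_scaleC: "i < k \<Longrightarrow> j < k \<Longrightarrow> f i j (c *\<^sub>C x) = c *\<^sub>C f i j x"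
    and f_mult: "i < k \<Longrightarrow> j < k \<Longrightarrow> f i j (x * y) = (\<Sum>r<k. f i r x * f r j y)"
    and f_star: "i < k \<Longrightarrow> j < k \<Longrightarrow> f i j (star x) = star (f j i x)"
    and P_f: "i < k \<Longrightarrow> j < k \<Longrightarrow> (\<Sum>r<k. P i r * f r j x) = f i j x"
    and f_P: "i < k \<Longrightarrow> j < k \<Longrightarrow> (\<Sum>r<k. f i r x * P r j) = f i j x"
    and f_g: "i < k \<Longrightarrow> j < k \<Longrightarrow> s < k \<Longrightarrow> v < k \<Longrightarrow> f i j (g s v x) = P i s * x * P v j"
    and f_inj: "(\<And>i j. i < k \<Longrightarrow> j < k \<Longrightarrow> f i j x = f i j y) \<Longrightarrow> x = y"
    and P_idem: "i < k \<Longrightarrow> j < k \<Longrightarrow> (\<Sum>r<k. P i r * P r j) = P i j"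
    and u: "m < n \<Longrightarrow> u m < k" and t: "m < n \<Longrightarrow> t m < k"
    and one: "(\<Sum>m<n. a m * P (u m) (t m) * b m) = 1"
begin

lemma f_zero: "i < k \<Longrightarrow> j < k \<Longrightarrow> f i j 0 = 0"
  using f_add[of i j 0 0] by simp

lemma f_sum: "i < k \<Longrightarrow> j < k \<Longrightarrow> f i j (\<Sum>l\<in>L. x l) = (\<Sum>l\<in>L. f i j (x l))"
  by (induction L rule: infinite_finite_induct) (auto simp: f_zero f_add)

lemma g_add: "s < k \<Longrightarrow> v < k \<Longrightarrow> g s v (x + y) = g s v x + g s v y"
  by (rule f_inj) (simp add: f_g f_add distrib_left distrib_right)

lemma g_scaleC: "s < k \<Longrightarrow> v < k \<Longrightarrow> g s v (c *\<^sub>C x) = c *\<^sub>C g s v x"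
  by (rule f_inj) (simp add: f_g f_scaleC mult_scaleC_left mult_scaleC_right)

lemma g_f: "(\<Sum>s<k. \<Sum>v<k. g s v (f s v x)) = x"
proof (rule f_inj)
  fix i j assume ij: "i < k" "j < k"
  have "f i j (\<Sum>s<k. \<Sum>v<k. g s v (f s v x)) = (\<Sum>v<k. (\<Sum>s<k. P i s * f s v x) * P v j)"
    unfolding sum_distrib_right by (subst sum.swap) (simp add: ij f_sum f_g)
  also have "\<dots> = f i j x" by (simp add: ij P_f f_P)
  finally show "f i j (\<Sum>s<k. \<Sum>v<k. g s v (f s v x)) = f i j x" .
qed

text \<open>This and the next formula turn multiplication by an entry of an image or by a preimage into
  composites of maps that do not depend on \<open>x\<close>, and left multiplication by \<open>x\<close>.\<close>

lemma g_mult: "s < k \<Longrightarrow> v < k \<Longrightarrow> g s v x * c = (\<Sum>j<k. g s j (x * f v j c))"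
proof (rule f_inj)
  fix i l assume *: "s < k" "v < k" "i < k" "l < k"
  have "f i l (g s v x * c) = P i s * x * (\<Sum>r<k. P v r * f r l c)"
    by (simp add: * f_mult f_g sum_distrib_left mult.assoc)
  also have "\<dots> = P i s * x * (\<Sum>j<k. f v j c * P j l)" by (simp add: * P_f f_P)
  also have "\<dots> = f i l (\<Sum>j<k. g s j (x * f v j c))"
    by (simp add: * f_sum f_g sum_distrib_left mult.assoc)
  finally show "f i l (g s v x * c) = f i l (\<Sum>j<k. g s j (x * f v j c))" .
qed

lemma f_mult_decomposition:
  assumes "i < k" "j < k"
  shows "f i j x * c = (\<Sum>m<n. f i (t m) (x * g j (u m) (c * a m)) * b m)"
proof -
  have "f i (t m) (x * g j (u m) (c * a m)) = f i j x * c * a m * P (u m) (t m)" if "m < n" for m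
  proof -
    have "f i (t m) (x * g j (u m) (c * a m)) = (\<Sum>r<k. f i r x * P r j) * (c * a m * P (u m) (t m))"
      using assms u[OF that] t[OF that] by (simp add: f_mult f_g sum_distrib_right mult.assoc)
    then show ?thesis using assms by (simp add: f_P mult.assoc)
  qed
  then have "(\<Sum>m<n. f i (t m) (x * g j (u m) (c * a m)) * b m) =
    f i j x * c * (\<Sum>m<n. a m * P (u m) (t m) * b m)"
    by (simp add: sum_distrib_left mult.assoc)
  then show ?thesis by (simp add: one)
qed

lemma f_star_square:
  "j < k \<Longrightarrow> f j j (star x * x) = (\<Sum>i<k. star (f i j x) * f i j x)"
  by (simp add: f_mult f_star)

definition matrix_trace :: "('a \<Rightarrow> complex) \<Rightarrow> 'a \<Rightarrow> complex" where
  "matrix_trace \<theta> x = (\<Sum>i<k. \<theta> (f i i x))"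

text \<open>Fullness makes a trace recoverable from its amplification to the corner: cyclicity moves the
  factors around an entry of \<open>P\<close> in the decomposition of \<open>1\<close> into an element of the corner.\<close>

lemma trace_recovered:
  assumes \<theta>: "\<theta> \<in> tracial_states UNIV"
  shows "\<theta> x = matrix_trace \<theta> (\<Sum>m<n. g (t m) (u m) (b m * x * a m))"
proof -
  have add: "\<theta> (x + y) = \<theta> x + \<theta> y" and scale: "\<theta> (c *\<^sub>C x) = c * \<theta> x"
    and trace: "\<theta> (x * y) = \<theta> (y * x)" for x y c
    using tracial_statesD[OF \<theta>] by (auto simp: functionals_on_def)
  have "\<theta> 0 = 0" using add[of 0 0] by simp
  then have sum: "\<theta> (\<Sum>l\<in>L. x l) = (\<Sum>l\<in>L. \<theta> (x l))" for L :: "nat set" and x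
    by (induction L rule: infinite_finite_induct) (auto simp: add)
  have g: "(\<Sum>i<k. \<theta> (f i i (g s v y))) = \<theta> (y * P v s)" if sv: "s < k" "v < k" for s v y
  proof -
    have "\<theta> (f i i (g s v y)) = \<theta> (y * (P v i * P i s))" if "i < k" for i
      using trace[of "P i s" "y * P v i"] sv that by (simp add: f_g mult.assoc)
    then have "(\<Sum>i<k. \<theta> (f i i (g s v y))) = \<theta> (y * (\<Sum>i<k. P v i * P i s))"
      by (simp add: sum_distrib_left flip: sum)
    then show ?thesis using sv by (simp add: P_idem)
  qed
  have "matrix_trace \<theta> (\<Sum>m<n. g (t m) (u m) (b m * x * a m)) =
    (\<Sum>m<n. \<Sum>i<k. \<theta> (f i i (g (t m) (u m) (b m * x * a m))))"
    unfolding matrix_trace_def by (subst sum.swap) (simp add: f_sum sum)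
  also have "\<dots> = (\<Sum>m<n. \<theta> (b m * (x * a m * P (u m) (t m))))"
    using u t by (simp add: g mult.assoc)
  also have "\<dots> = \<theta> (x * (\<Sum>m<n. a m * P (u m) (t m) * b m))"
    by (subst trace) (simp add: sum sum_distrib_left mult.assoc)
  finally show ?thesis by (simp add: one)
qed

lemma matrix_trace_positive:
  assumes "\<theta> \<in> tracial_states UNIV"
  shows "matrix_trace \<theta> (star x * x) \<in> \<real>\<^sub>\<ge>\<^sub>0"
proof -
  interpret positive_functional UNIV \<theta>
    using assms by (intro tracial_state_positive_functional) auto
  have "\<theta> 0 = 0" using linear(1)[of 0 0] by simp
  then have "\<theta> (\<Sum>l\<in>L. x l) = (\<Sum>l\<in>L. \<theta> (x l))" for L :: "nat set" and x
    by (induction L rule: infinite_finite_induct) (auto simp: linear)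
  then show ?thesis
    unfolding matrix_trace_def by (auto simp: f_star_square intro!: sum_in_nonneg_Reals positive)
qed

end

lemma star_projection_image:
  assumes "unital_star_representation \<pi>" and p: "p \<in> carrier_mat k k" "mat_projection p"
  shows "mat_projection (map_mat \<pi> p)"
proof -
  have rep: "\<pi> (a + b) = \<pi> a + \<pi> b" "\<pi> (a * b) = \<pi> a * \<pi> b" "\<pi> (star a) = star (\<pi> a)" for a b
    using assms(1) by (auto simp: unital_star_representation_def)
  have "\<pi> 0 = 0" using rep(1)[of 0 0] by simp
  then have sum: "\<pi> (\<Sum>i\<in>I. x i) = (\<Sum>i\<in>I. \<pi> (x i))" for I :: "nat set" and x
    by (induction I rule: infinite_finite_induct) (auto simp: rep)
  have pp: "p * p = p" "star_mat p = p" using p(2) by (auto simp: mat_projection_def)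
  have "map_mat \<pi> p * map_mat \<pi> p = map_mat \<pi> p"
  proof (rule eq_matI)
    fix i j assume "i < dim_row (map_mat \<pi> p)" "j < dim_col (map_mat \<pi> p)"
    then have ij: "i < k" "j < k" using p(1) by auto
    have "(map_mat \<pi> p * map_mat \<pi> p) $$ (i, j) = \<pi> ((p * p) $$ (i, j))"
      using ij p(1) by (simp add: index_mult_mat_sum[of _ k] sum rep del: index_mult_mat(1))
    then show "(map_mat \<pi> p * map_mat \<pi> p) $$ (i, j) = map_mat \<pi> p $$ (i, j)"
      using ij p(1) by (simp add: pp)
  qed auto
  moreover have "star_mat (map_mat \<pi> p) = map_mat \<pi> (star_mat p)"
    by (rule eq_matI) (auto simp: star_mat_def rep)
  ultimately show ?thesis by (simp add: mat_projection_def pp)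
qed

lemma full_triple_entries:
  fixes p :: "'a::unital_cstar_algebra mat"
  assumes "(k, p, \<Phi>) \<in> full_self_similar_triples"
  shows "\<exists>g n a b u t.
    full_corner_entries k (\<lambda>i j. p $$ (i, j)) (\<lambda>i j x. \<Phi> x $$ (i, j)) g n a b u t"
proof -
  have k: "0 < k" and p: "p \<in> carrier_mat k k" and proj: "p * p = p" "star_mat p = p"
    and iso: "star_isomorphism UNIV (corner k UNIV p) \<Phi>" and full: "full_mat k p"
    using assms by (auto simp: full_self_similar_triples_def self_similar_triples_def
        matrices_over_def mat_projection_def)
  obtain n :: nat and u t :: "nat \<Rightarrow> nat" and a b :: "nat \<Rightarrow> 'a" where ut: "\<forall>m<n. u m < k \<and> t m < k"
    and one: "(\<Sum>m<n. a m * p $$ (u m, t m) * b m) = 1"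
    using full_matrix_generates_one[OF full p k] by blast
  have \<Phi>: "\<Phi> (x + y) = \<Phi> x + \<Phi> y" "\<Phi> (x * y) = \<Phi> x * \<Phi> y" "\<Phi> (c *\<^sub>C x) = scaleC_mat c (\<Phi> x)"
    "\<Phi> (star x) = star_mat (\<Phi> x)" for x y c
    using iso by (auto simp: star_isomorphism_def)
  have bij: "bij_betw \<Phi> UNIV (corner k UNIV p)" using iso by (simp add: star_isomorphism_def)
  have corner: "X \<in> carrier_mat k k \<and> p * X = X \<and> X * p = X" if X: "X \<in> corner k UNIV p" for X
  proof -
    obtain Y where Y: "Y \<in> carrier_mat k k" "X = p * Y * p"
      using X by (auto simp: corner_def matrices_over_def)
    have pY: "p * Y \<in> carrier_mat k k" using p Y(1) by (rule mult_carrier_mat)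
    have "p * X = p * (p * Y) * p" unfolding Y(2) by (rule assoc_mult_mat[OF p pY p, symmetric])
    also have "p * (p * Y) = p * Y" using assoc_mult_mat[OF p p Y(1)] proj by simp
    finally have 1: "p * X = X" using Y(2) by simp
    have "X * p = p * Y * (p * p)" unfolding Y(2) by (rule assoc_mult_mat[OF pY p p])
    then have 2: "X * p = X" using Y(2) proj by simp
    show ?thesis using 1 2 mult_carrier_mat[OF pY p] Y(2) by simp
  qed
  have \<Phi>_corner: "\<Phi> x \<in> corner k UNIV p" for x
    using bij by (auto simp: bij_betw_def)
  note \<Phi>_carrier = corner[OF \<Phi>_corner, THEN conjunct1]
  note \<Phi>_dim = carrier_matD[OF \<Phi>_carrier]
  define E where "E s v x = mat k k (\<lambda>(i, j). if i = s \<and> j = v then x else 0)" for s v and x :: 'a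
  have E_carrier: "E s v x \<in> carrier_mat k k" for s v x by (simp add: E_def)
  have pEp: "(p * E s v x * p) $$ (i, j) = p $$ (i, s) * x * p $$ (v, j)"
    if "i < k" "j < k" "s < k" "v < k" for i j s v x
  proof -
    have 1: "(p * E s v x) $$ (i, r) = (if r = v then p $$ (i, s) * x else 0)" if "r < k" for r
    proof -
      have "(p * E s v x) $$ (i, r) = (\<Sum>q<k. if q = s then (if r = v then p $$ (i, s) * x else 0) else 0)"
        unfolding index_mult_mat_sum[OF p E_carrier \<open>i < k\<close> \<open>r < k\<close>]
        using \<open>r < k\<close> by (intro sum.cong) (auto simp: E_def)
      then show ?thesis using \<open>s < k\<close> by (simp add: sum.delta)
    qed
    have "(p * E s v x * p) $$ (i, j) = (\<Sum>r<k. if r = v then p $$ (i, s) * x * p $$ (v, j) else 0)"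
      unfolding index_mult_mat_sum[OF mult_carrier_mat[OF p E_carrier] p \<open>i < k\<close> \<open>j < k\<close>]
      by (intro sum.cong) (auto simp: 1)
    then show ?thesis using \<open>v < k\<close> by (simp add: sum.delta)
  qed
  define g where "g s v x = inv_into UNIV \<Phi> (p * E s v x * p)" for s v x
  have \<Phi>_g: "\<Phi> (g s v x) = p * E s v x * p" for s v x
  proof -
    have "p * E s v x * p \<in> corner k UNIV p"
      unfolding corner_def matrices_over_def using E_carrier[of s v x] by blast
    then show ?thesis
      unfolding g_def using bij by (intro f_inv_into_f) (auto simp: bij_betw_def)
  qed
  have "full_corner_entries k (\<lambda>i j. p $$ (i, j)) (\<lambda>i j x. \<Phi> x $$ (i, j)) g n a b u t"
  proof
    fix i j x y c s v assume ij: "i < k" "j < k"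
    show "\<Phi> (x + y) $$ (i, j) = \<Phi> x $$ (i, j) + \<Phi> y $$ (i, j)"
      using ij by (simp add: \<Phi> \<Phi>_dim)
    show "\<Phi> (c *\<^sub>C x) $$ (i, j) = c *\<^sub>C \<Phi> x $$ (i, j)"
      using ij by (simp add: \<Phi> \<Phi>_dim scaleC_mat_def)
    show "\<Phi> (x * y) $$ (i, j) = (\<Sum>r<k. \<Phi> x $$ (i, r) * \<Phi> y $$ (r, j))"
      unfolding \<Phi> by (rule index_mult_mat_sum[OF \<Phi>_carrier \<Phi>_carrier ij])
    show "\<Phi> (star x) $$ (i, j) = star (\<Phi> x $$ (j, i))"
      using ij by (simp add: \<Phi> \<Phi>_dim star_mat_def)
    show "(\<Sum>r<k. p $$ (i, r) * \<Phi> x $$ (r, j)) = \<Phi> x $$ (i, j)"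
      using index_mult_mat_sum[OF p \<Phi>_carrier ij, of x] corner[OF \<Phi>_corner, of x] by simp
    show "(\<Sum>r<k. \<Phi> x $$ (i, r) * p $$ (r, j)) = \<Phi> x $$ (i, j)"
      using index_mult_mat_sum[OF \<Phi>_carrier p ij, of x] corner[OF \<Phi>_corner, of x] by simp
    show "(\<Sum>r<k. p $$ (i, r) * p $$ (r, j)) = p $$ (i, j)"
      using index_mult_mat_sum[OF p p ij] proj by simp
    assume "s < k" "v < k"
    then show "\<Phi> (g s v x) $$ (i, j) = p $$ (i, s) * x * p $$ (v, j)"
      using ij by (simp add: \<Phi>_g pEp del: index_mult_mat)
  next
    fix x y assume "\<And>i j. i < k \<Longrightarrow> j < k \<Longrightarrow> \<Phi> x $$ (i, j) = \<Phi> y $$ (i, j)"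
    then have "\<Phi> x = \<Phi> y" by (intro eq_matI) (auto simp: \<Phi>_dim)
    then show "x = y" using bij by (auto simp: bij_betw_def dest: injD)
  qed (use ut one in auto)
  then show ?thesis by blast
qed


section \<open>Comparison of the traces\<close>

lemma (in full_corner_entries) matrix_traces_not_proportional:
  assumes T: "\<theta>1 \<in> tracial_states UNIV" "\<theta>2 \<in> tracial_states UNIV"
    and eq: "\<And>x. matrix_trace \<theta>1 x = c1 * \<theta> x" "\<And>x. matrix_trace \<theta>2 x = c2 * \<theta> x"
  shows "\<theta>1 = \<theta>2"
proof -
  define J where "J x = (\<Sum>m<n. g (t m) (u m) (b m * x * a m))" for x
  have 1: "\<theta>1 x = c1 * \<theta> (J x)" and 2: "\<theta>2 x = c2 * \<theta> (J x)" for x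
    using trace_recovered[OF T(1), of x] trace_recovered[OF T(2), of x] by (simp_all add: eq J_def)
  have "c1 * \<theta> (J 1) = 1" "c2 * \<theta> (J 1) = 1"
    using 1[of 1] 2[of 1] tracial_statesD(2)[OF T(1)] tracial_statesD(2)[OF T(2)] by simp_all
  then have "c1 = c2" by (metis mult_cancel_right mult_zero_right zero_neq_one)
  then show ?thesis using 1 2 by auto
qed

text \<open>The coefficients are nonnegative by extremality, and no column of the matrix vanishes, since
  otherwise the two amplified traces would be proportional on the corner, and hence, by fullness,
  the two traces themselves.\<close>

lemma (in full_corner_entries) matrix_trace_comparable:
  assumes ext: "\<phi>1 \<in> extreme_points (tracial_states UNIV)" "\<phi>2 \<in> extreme_points (tracial_states UNIV)"
    and ne: "\<phi>1 \<noteq> \<phi>2"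
    and eq1: "\<And>x. matrix_trace \<phi>1 x = a11 * \<phi>1 x + a12 * \<phi>2 x"
    and eq2: "\<And>x. matrix_trace \<phi>2 x = a21 * \<phi>1 x + a22 * \<phi>2 x"
    and \<phi>: "\<phi> = (\<lambda>x. 1/2 * (\<phi>1 x + \<phi>2 x))"
  obtains C C' where "\<And>x. Re (matrix_trace \<phi> (star x * x)) \<le> C * Re (\<phi> (star x * x))"
    and "\<And>x. Re (\<phi> (star x * x)) \<le> C' * Re (matrix_trace \<phi> (star x * x))"
proof -
  have T: "\<phi>1 \<in> tracial_states UNIV" "\<phi>2 \<in> tracial_states UNIV"
    using ext by (auto simp: extreme_points_def)
  note pos = matrix_trace_positive[OF T(1)] matrix_trace_positive[OF T(2)]
  have pos1: "a11 * \<phi>1 (star x * x) + a12 * \<phi>2 (star x * x) \<in> \<real>\<^sub>\<ge>\<^sub>0"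
    and pos2: "a21 * \<phi>1 (star x * x) + a22 * \<phi>2 (star x * x) \<in> \<real>\<^sub>\<ge>\<^sub>0" for x
    using pos[of x] by (simp_all add: eq1 eq2)
  have "a11 \<in> \<real>\<^sub>\<ge>\<^sub>0" "a21 \<in> \<real>\<^sub>\<ge>\<^sub>0"
    using extreme_pair_coefficient_nonneg[OF ext ne pos1] extreme_pair_coefficient_nonneg[OF ext ne pos2]
    by auto
  moreover have "a12 \<in> \<real>\<^sub>\<ge>\<^sub>0" "a22 \<in> \<real>\<^sub>\<ge>\<^sub>0"
    using pos1 pos2 extreme_pair_coefficient_nonneg[OF ext(2,1) ne[symmetric], of a12 a11]
      extreme_pair_coefficient_nonneg[OF ext(2,1) ne[symmetric], of a22 a21]
    by (simp_all add: add.commute)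
  ultimately have nonneg: "a11 = of_real (Re a11)" "a12 = of_real (Re a12)"
      "a21 = of_real (Re a21)" "a22 = of_real (Re a22)"
      "Re a11 \<ge> 0" "Re a12 \<ge> 0" "Re a21 \<ge> 0" "Re a22 \<ge> 0"
    by (auto simp: complex_nonneg_Reals_iff complex_eq_iff)
  define c d where "c = Re a11 + Re a21" and "d = Re a12 + Re a22"
  have "c \<noteq> 0"
  proof
    assume "c = 0"
    then have "a11 = 0" "a21 = 0" using nonneg unfolding c_def
      by (metis add_nonneg_eq_0_iff of_real_0)+
    then show False
      using matrix_traces_not_proportional[OF T, of a12 \<phi>2 a22] eq1 eq2 ne by simp
  qed
  moreover have "d \<noteq> 0"
  proof
    assume "d = 0"
    then have "a12 = 0" "a22 = 0" using nonneg unfolding d_def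
      by (metis add_nonneg_eq_0_iff of_real_0)+
    then show False
      using matrix_traces_not_proportional[OF T, of a11 \<phi>1 a21] eq1 eq2 ne by simp
  qed
  ultimately have cd: "c > 0" "d > 0" using nonneg by (auto simp: c_def d_def)
  have tr: "Re (matrix_trace \<phi> x) = (c * Re (\<phi>1 x) + d * Re (\<phi>2 x)) / 2" for x
  proof -
    have "matrix_trace \<phi> x = 1/2 * (matrix_trace \<phi>1 x + matrix_trace \<phi>2 x)"
      by (simp add: matrix_trace_def \<phi> sum.distrib sum_distrib_left flip: sum_divide_distrib)
    also have "\<dots> = 1/2 * (of_real c * \<phi>1 x + of_real d * \<phi>2 x)"
      unfolding eq1 eq2 c_def d_def by (subst nonneg(1), subst nonneg(2), subst nonneg(3), subst nonneg(4))
        (simp add: algebra_simps)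
    finally have e: "matrix_trace \<phi> x = 1/2 * (of_real c * \<phi>1 x + of_real d * \<phi>2 x)" .
    show ?thesis unfolding e by simp
  qed
  have nn: "0 \<le> Re (\<phi>1 (star x * x))" "0 \<le> Re (\<phi>2 (star x * x))" for x
    using tracial_statesD(4)[OF T(1), of x] tracial_statesD(4)[OF T(2), of x]
    by (auto simp: complex_nonneg_Reals_iff)
  have re: "Re (\<phi> x) = (Re (\<phi>1 x) + Re (\<phi>2 x)) / 2" for x by (simp add: \<phi>)
  show ?thesis
  proof (rule that)
    fix x
    let ?x1 = "Re (\<phi>1 (star x * x))" and ?x2 = "Re (\<phi>2 (star x * x))"
    have "0 \<le> d * ?x1" "0 \<le> c * ?x2" using nn[of x] cd by simp_all
    then show "Re (matrix_trace \<phi> (star x * x)) \<le> (c + d) * Re (\<phi> (star x * x))"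
      by (simp add: tr re algebra_simps)
    have "?x1 + ?x2 \<le> (1 / c + 1 / d) * (c * ?x1 + d * ?x2)"
      using nn[of x] cd by (simp add: field_simps)
    from divide_right_mono[OF this, of 2]
    show "Re (\<phi> (star x * x)) \<le> (1 / c + 1 / d) * Re (matrix_trace \<phi> (star x * x))"
      by (simp add: tr re)
  qed
qed


section \<open>Extension of the isomorphism to the weak closure\<close>

locale gns_corner = gns_trace \<phi> \<pi> \<xi> + full_corner_entries k P f g n a b u t
  for \<phi> and \<pi> :: "'a::complex_star_algebra \<Rightarrow> 'h::complex_hilbert_space bounded_op" and \<xi>
    and k and P :: "nat \<Rightarrow> nat \<Rightarrow> 'a" and f g n a b u t +
  fixes C C' :: real
  assumes upper: "Re (matrix_trace \<phi> (star x * x)) \<le> C * Re (\<phi> (star x * x))"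
    and lower: "Re (\<phi> (star x * x)) \<le> C' * Re (matrix_trace \<phi> (star x * x))"
begin

lemma matrix_trace_square:
  "Re (matrix_trace \<phi> (star x * x)) = (\<Sum>j<k. \<Sum>i<k. (norm (vec (f i j x)))\<^sup>2)"
proof -
  have \<phi>: "\<phi> (x + y) = \<phi> x + \<phi> y" for x y
    using tracial_statesD(1)[OF state] by (simp add: functionals_on_def)
  have "\<phi> 0 = 0" using \<phi>[of 0 0] by simp
  then have "\<phi> (\<Sum>l\<in>L. x l) = (\<Sum>l\<in>L. \<phi> (x l))" for L :: "nat set" and x
    by (induction L rule: infinite_finite_induct) (auto simp: \<phi>)
  then show ?thesis
    by (simp add: matrix_trace_def f_star_square norm_vec)
qed

text \<open>The upper bound on the amplified trace says that the entries of \<open>\<Phi>\<close> are bounded for the norm of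
  the GNS space; the lower bound says the same for the inverse of \<open>\<Phi>\<close>.\<close>

lemma entry_operators:
  obtains F where "\<And>i j x. i < k \<Longrightarrow> j < k \<Longrightarrow> apply_op (F i j) (vec x) = vec (f i j x)"
proof -
  have "\<exists>F. \<forall>x. apply_op F (vec x) = vec (f i j x)" if ij: "i < k" "j < k" for i j
  proof (rule operator_of_bounded_map)
    fix x
    have "(norm (vec (f i j x)))\<^sup>2 \<le> (\<Sum>i<k. (norm (vec (f i j x)))\<^sup>2)"
      using ij by (intro member_le_sum[of i "{..<k}" "\<lambda>i. (norm (vec (f i j x)))\<^sup>2"]) auto
    also have "\<dots> \<le> (\<Sum>j<k. \<Sum>i<k. (norm (vec (f i j x)))\<^sup>2)"
      using ij by (intro member_le_sum[of j "{..<k}" "\<lambda>j. \<Sum>i<k. (norm (vec (f i j x)))\<^sup>2"] sum_nonneg) auto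
    also have "\<dots> \<le> C * (norm (vec x))\<^sup>2"
      using upper[of x] by (simp add: matrix_trace_square norm_vec)
    also have "\<dots> \<le> \<bar>C\<bar> * (norm (vec x))\<^sup>2" by (intro mult_right_mono) auto
    also have "\<dots> = (sqrt \<bar>C\<bar> * norm (vec x))\<^sup>2" by (simp add: power_mult_distrib)
    finally show "norm (vec (f i j x)) \<le> sqrt \<bar>C\<bar> * norm (vec x)"
      by (rule power2_le_imp_le) simp
  qed (use ij in \<open>simp_all add: f_add f_scaleC vec_add vec_scaleC\<close>)
  then have "\<forall>i j. \<exists>F. i < k \<longrightarrow> j < k \<longrightarrow> (\<forall>x. apply_op F (vec x) = vec (f i j x))" by blast
  then obtain F where "\<forall>i j. i < k \<longrightarrow> j < k \<longrightarrow> (\<forall>x. apply_op (F i j) (vec x) = vec (f i j x))"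
    by metis
  then show ?thesis using that by blast
qed

lemma right_multiplications:
  obtains R where "\<And>c x. apply_op (R c) (vec x) = vec (x * c)"
  using right_multiplication_operator by metis

lemma preimage_operators:
  obtains G where "\<And>s v x. s < k \<Longrightarrow> v < k \<Longrightarrow> apply_op (G s v) (vec x) = vec (g s v x)"
proof -
  obtain R where R: "\<And>c x. apply_op (R c) (vec x) = vec (x * c)"
    using right_multiplications by metis
  have "\<exists>G. \<forall>x. apply_op G (vec x) = vec (g s v x)" if sv: "s < k" "v < k" for s v
  proof -
    have "\<exists>K. \<forall>x. norm (vec (P i s * x * P v j)) \<le> K * norm (vec x)" for i j
    proof -
      obtain K where K: "\<And>x. norm (apply_op (\<pi> (P i s) * R (P v j)) x) \<le> K * norm x"
        using apply_op_bound by blast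
      show ?thesis using K[of "vec _"] by (simp add: R apply_rep_vec mult.assoc) blast
    qed
    then obtain K where K: "\<And>i j x. norm (vec (P i s * x * P v j)) \<le> K i j * norm (vec x)"
      by metis
    define L where "L = \<bar>C'\<bar> * (\<Sum>j<k. \<Sum>i<k. (K i j)\<^sup>2)"
    show ?thesis
    proof (rule operator_of_bounded_map)
      fix x
      have "(norm (vec (g s v x)))\<^sup>2 \<le> C' * (\<Sum>j<k. \<Sum>i<k. (norm (vec (P i s * x * P v j)))\<^sup>2)"
        using lower[of "g s v x"] sv by (simp add: matrix_trace_square norm_vec[symmetric] f_g)
      also have "\<dots> \<le> \<bar>C'\<bar> * (\<Sum>j<k. \<Sum>i<k. (norm (vec (P i s * x * P v j)))\<^sup>2)"
        by (intro mult_right_mono sum_nonneg) auto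
      also have "\<dots> \<le> \<bar>C'\<bar> * (\<Sum>j<k. \<Sum>i<k. (K i j * norm (vec x))\<^sup>2)"
        by (intro mult_left_mono sum_mono power_mono K) auto
      also have "\<dots> = L * (norm (vec x))\<^sup>2"
        by (simp add: L_def power_mult_distrib sum_distrib_right mult.assoc)
      also have "\<dots> = (sqrt L * norm (vec x))\<^sup>2"
        by (simp add: power_mult_distrib L_def sum_nonneg)
      finally show "norm (vec (g s v x)) \<le> sqrt L * norm (vec x)"
        by (rule power2_le_imp_le) (simp add: L_def sum_nonneg)
    qed (use sv in \<open>simp_all add: g_add g_scaleC vec_add vec_scaleC\<close>)
  qed
  then have "\<forall>s v. \<exists>G. s < k \<longrightarrow> v < k \<longrightarrow> (\<forall>x. apply_op G (vec x) = vec (g s v x))" by blast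
  then obtain G where "\<forall>s v. s < k \<longrightarrow> v < k \<longrightarrow> (\<forall>x. apply_op (G s v) (vec x) = vec (g s v x))"
    by metis
  then show ?thesis using that by blast
qed

text \<open>The formulas for \<open>f i j x * c\<close> and \<open>g s v x * c\<close> express \<open>\<pi> (f i j x)\<close> and \<open>\<pi> (g s v x)\<close> as
  finite sums \<open>\<Sum> A (\<pi> x) B\<close> with bounded operators \<open>A\<close> and \<open>B\<close>, which make sense, and are weakly
  continuous, for all bounded operators in place of \<open>\<pi> x\<close>.\<close>

lemma weakly_continuous_extensions:
  obtains f' g' where
    "\<And>i j. continuous_map WOT WOT (f' i j)" "\<And>i j. continuous_map WOT WOT (g' i j)"
    "\<And>i j x. i < k \<Longrightarrow> j < k \<Longrightarrow> f' i j (\<pi> x) = \<pi> (f i j x)"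
    "\<And>i j x. i < k \<Longrightarrow> j < k \<Longrightarrow> g' i j (\<pi> x) = \<pi> (g i j x)"
    "\<And>i j x y. f' i j (x + y) = f' i j x + f' i j y"
    "\<And>i j c x. f' i j (c *\<^sub>C x) = c *\<^sub>C f' i j x"
proof -
  obtain F where F: "\<And>i j x. i < k \<Longrightarrow> j < k \<Longrightarrow> apply_op (F i j) (vec x) = vec (f i j x)"
    using entry_operators by metis
  obtain G where G: "\<And>i j x. i < k \<Longrightarrow> j < k \<Longrightarrow> apply_op (G i j) (vec x) = vec (g i j x)"
    using preimage_operators by metis
  obtain R where R: "\<And>c x. apply_op (R c) (vec x) = vec (x * c)"
    using right_multiplications by metis
  define f' where "f' i j x = (\<Sum>m<n. R (b m) * F i (t m) * x * G j (u m) * R (a m))" for i j x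
  define g' where "g' i j x = (\<Sum>l<k. G i l * x * F j l)" for i j x
  have sum_scaleC: "c *\<^sub>C (\<Sum>l\<in>L. x l) = (\<Sum>l\<in>L. c *\<^sub>C x l)"
    for c and L :: "nat set" and x :: "nat \<Rightarrow> 'h bounded_op"
    by (induction L rule: infinite_finite_induct) (auto simp: scaleC_add_right)
  show ?thesis
  proof (rule that)
    show "continuous_map WOT WOT (f' i j)" for i j unfolding f'_def by (intro WOT_intros)
    show "continuous_map WOT WOT (g' i j)" for i j unfolding g'_def by (intro WOT_intros)
    show "f' i j (\<pi> x) = \<pi> (f i j x)" if "i < k" "j < k" for i j x
    proof (rule op_eqI_vec)
      fix c
      have "apply_op (f' i j (\<pi> x)) (vec c) =
        (\<Sum>m<n. vec (f i (t m) (x * g j (u m) (c * a m)) * b m))"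
        using that u t by (simp add: f'_def apply_op_sum R F G apply_rep_vec)
      then show "apply_op (f' i j (\<pi> x)) (vec c) = apply_op (\<pi> (f i j x)) (vec c)"
        using that by (simp add: apply_rep_vec f_mult_decomposition vec_sum)
    qed
    show "g' i j (\<pi> x) = \<pi> (g i j x)" if "i < k" "j < k" for i j x
    proof (rule op_eqI_vec)
      fix c
      have "apply_op (g' i j (\<pi> x)) (vec c) = (\<Sum>l<k. vec (g i l (x * f j l c)))"
        using that by (simp add: g'_def apply_op_sum F G apply_rep_vec)
      then show "apply_op (g' i j (\<pi> x)) (vec c) = apply_op (\<pi> (g i j x)) (vec c)"
        using that by (simp add: apply_rep_vec g_mult vec_sum)
    qed
    show "f' i j (x + y) = f' i j x + f' i j y" for i j x y
      by (simp add: f'_def distrib_left distrib_right sum.distrib)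
    show "f' i j (c *\<^sub>C x) = c *\<^sub>C f' i j x" for i j c x
      by (simp add: f'_def mult_scaleC_left mult_scaleC_right sum_scaleC)
  qed
qed

text \<open>The extended entries inherit every identity from the dense subalgebra. Injectivity is the
  identity \<open>\<Sum> g s v (f s v x) = x\<close>, and surjectivity the one for \<open>f i j (g s v x)\<close>.\<close>

lemma corner_isomorphism_extends:
  assumes p: "p \<in> carrier_mat k k" and P: "\<And>i j. P i j = p $$ (i, j)"
  obtains f' where "\<And>i j. continuous_map WOT WOT (f' i j)"
    and "\<And>i j x. i < k \<Longrightarrow> j < k \<Longrightarrow> f' i j (\<pi> x) = \<pi> (f i j x)"
    and "star_isomorphism N (corner k N (map_mat \<pi> p)) (\<lambda>x. mat k k (\<lambda>(i, j). f' i j x))"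
proof -
  obtain f' g' where cont: "\<And>i j. continuous_map WOT WOT (f' i j)" "\<And>i j. continuous_map WOT WOT (g' i j)"
    and f'\<pi>: "\<And>i j x. i < k \<Longrightarrow> j < k \<Longrightarrow> f' i j (\<pi> x) = \<pi> (f i j x)"
    and g'\<pi>: "\<And>i j x. i < k \<Longrightarrow> j < k \<Longrightarrow> g' i j (\<pi> x) = \<pi> (g i j x)"
    and f'_add: "\<And>i j x y. f' i j (x + y) = f' i j x + f' i j y"
    and f'_scaleC: "\<And>i j c x. f' i j (c *\<^sub>C x) = c *\<^sub>C f' i j x"
    using weakly_continuous_extensions by metis
  note cont_comp = cont[THEN continuous_map_compose[unfolded comp_def, rotated]]
  have f'_zero: "f' i j 0 = 0" for i j using f'_add[of i j 0 0] by simp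
  have f'_sum: "f' i j (\<Sum>l\<in>L. x l) = (\<Sum>l\<in>L. f' i j (x l))" for i j and L :: "nat set" and x
    by (induction L rule: infinite_finite_induct) (auto simp: f'_zero f'_add)
  have f'_N: "f' i j x \<in> N" if "i < k" "j < k" "x \<in> N" for i j x
    by (rule maps_N_into_N[OF cont(1) _ that(3)]) (simp add: f'\<pi> that rep_in_N)
  have g'_N: "g' i j x \<in> N" if "i < k" "j < k" "x \<in> N" for i j x
    by (rule maps_N_into_N[OF cont(2) _ that(3)]) (simp add: g'\<pi> that rep_in_N)
  have f'_mult: "f' i j (x * y) = (\<Sum>r<k. f' i r x * f' r j y)"
    if ij: "i < k" "j < k" and xy: "x \<in> N" "y \<in> N" for i j x y
  proof (rule eq_on_N[OF _ _ _ xy(1)])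
    fix c
    show "f' i j (\<pi> c * y) = (\<Sum>r<k. f' i r (\<pi> c) * f' r j y)"
    proof (rule eq_on_N[OF _ _ _ xy(2)])
      fix d
      show "f' i j (\<pi> c * \<pi> d) = (\<Sum>r<k. f' i r (\<pi> c) * f' r j (\<pi> d))"
        using ij by (simp add: f'\<pi> f_mult rep_sum flip: rep(3))
    qed (intro cont_comp cont WOT_intros)+
  qed (intro cont_comp cont WOT_intros)+
  have f'_star: "f' i j (star x) = star (f' j i x)" if ij: "i < k" "j < k" and x: "x \<in> N" for i j x
  proof (rule eq_on_N[OF _ _ _ x])
    show "f' i j (star (\<pi> c)) = star (f' j i (\<pi> c))" for c
      using ij by (simp add: f'\<pi> f_star flip: rep(4))
  qed (intro cont_comp cont WOT_intros)+
  have P_f': "(\<Sum>r<k. \<pi> (P i r) * f' r j x) = f' i j x"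
    and f'_P: "(\<Sum>r<k. f' i r x * \<pi> (P r j)) = f' i j x"
    if ij: "i < k" "j < k" and x: "x \<in> N" for i j x
  proof -
    show "(\<Sum>r<k. \<pi> (P i r) * f' r j x) = f' i j x"
    proof (rule eq_on_N[OF _ _ _ x])
      show "(\<Sum>r<k. \<pi> (P i r) * f' r j (\<pi> c)) = f' i j (\<pi> c)" for c
        using ij by (simp add: f'\<pi> flip: rep(3) rep_sum) (simp add: P_f)
    qed (intro cont_comp cont WOT_intros)+
    show "(\<Sum>r<k. f' i r x * \<pi> (P r j)) = f' i j x"
    proof (rule eq_on_N[OF _ _ _ x])
      show "(\<Sum>r<k. f' i r (\<pi> c) * \<pi> (P r j)) = f' i j (\<pi> c)" for c
        using ij by (simp add: f'\<pi> flip: rep(3) rep_sum) (simp add: f_P)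
    qed (intro cont_comp cont WOT_intros)+
  qed
  have f'_g': "f' i j (g' s v x) = \<pi> (P i s) * x * \<pi> (P v j)"
    if ij: "i < k" "j < k" "s < k" "v < k" and x: "x \<in> N" for i j s v x
  proof (rule eq_on_N[OF _ _ _ x])
    show "f' i j (g' s v (\<pi> c)) = \<pi> (P i s) * \<pi> c * \<pi> (P v j)" for c
      using ij by (simp add: f'\<pi> g'\<pi> f_g)
  qed (intro cont_comp cont WOT_intros)+
  have g'_f': "(\<Sum>s<k. \<Sum>v<k. g' s v (f' s v x)) = x" if x: "x \<in> N" for x
  proof (rule eq_on_N[OF _ _ _ x])
    show "(\<Sum>s<k. \<Sum>v<k. g' s v (f' s v (\<pi> c))) = \<pi> c" for c
      by (simp add: f'\<pi> g'\<pi> g_f flip: rep_sum)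
  qed (intro cont_comp cont WOT_intros)+
  define \<Psi> where "\<Psi> x = mat k k (\<lambda>(i, j). f' i j x)" for x
  let ?p = "map_mat \<pi> p"
  have carrier: "\<Psi> x \<in> carrier_mat k k" "?p \<in> carrier_mat k k" for x
    using p by (auto simp: \<Psi>_def)
  have entry: "\<Psi> x $$ (i, j) = f' i j x" "?p $$ (i, j) = \<pi> (P i j)" if "i < k" "j < k" for i j x
    using that p by (auto simp: \<Psi>_def P)
  have inj: "inj_on \<Psi> N"
  proof (rule inj_onI)
    fix x y assume xy: "x \<in> N" "y \<in> N" and eq: "\<Psi> x = \<Psi> y"
    have "f' s v x = f' s v y" if "s < k" "v < k" for s v
      using eq that by (metis entry(1))
    then have "(\<Sum>s<k. \<Sum>v<k. g' s v (f' s v x)) = (\<Sum>s<k. \<Sum>v<k. g' s v (f' s v y))" by simp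
    then show "x = y" using xy by (simp add: g'_f')
  qed
  have into: "\<Psi> x \<in> corner k N ?p" if x: "x \<in> N" for x
  proof -
    have pX: "?p * \<Psi> x = \<Psi> x"
      using carrier(1)[of x] carrier(2) x by (intro eq_matI) (auto simp: index_mult_mat_sum entry P_f'[unfolded P] simp del: index_mult_mat(1))
    have Xp: "\<Psi> x * ?p = \<Psi> x"
      using carrier(1)[of x] carrier(2) x by (intro eq_matI) (auto simp: index_mult_mat_sum entry f'_P[unfolded P] simp del: index_mult_mat(1))
    have "\<Psi> x = ?p * \<Psi> x * ?p" by (simp add: pX Xp)
    moreover have "\<Psi> x \<in> matrices_over k N"
      using x by (auto simp: matrices_over_def entry f'_N carrier)
    ultimately show ?thesis unfolding corner_def by blast
  qed
  have onto: "Y \<in> \<Psi> ` N" if Y: "Y \<in> corner k N ?p" for Y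
  proof -
    obtain X where X: "X \<in> carrier_mat k k" "\<And>i j. i < k \<Longrightarrow> j < k \<Longrightarrow> X $$ (i, j) \<in> N"
      and YX: "Y = ?p * X * ?p"
      using Y by (auto simp: corner_def matrices_over_def)
    define x where "x = (\<Sum>s<k. \<Sum>v<k. g' s v (X $$ (s, v)))"
    have x: "x \<in> N" unfolding x_def by (intro N_sum g'_N X(2)) auto
    have "Y = \<Psi> x"
    proof (rule eq_matI)
      show "dim_row Y = dim_row (\<Psi> x)" "dim_col Y = dim_col (\<Psi> x)"
        using YX p by (auto simp: \<Psi>_def)
      fix i j assume "i < dim_row (\<Psi> x)" "j < dim_col (\<Psi> x)"
      then have ij: "i < k" "j < k" by (auto simp: \<Psi>_def)
      have pX: "?p * X \<in> carrier_mat k k" using carrier(2) X(1) by (rule mult_carrier_mat)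
      have "Y $$ (i, j) = (\<Sum>v<k. (\<Sum>s<k. \<pi> (P i s) * X $$ (s, v)) * \<pi> (P v j))"
        unfolding YX using ij
        by (simp add: index_mult_mat_sum[OF pX carrier(2)] index_mult_mat_sum[OF carrier(2) X(1)] entry
            del: index_mult_mat(1))
      also have "\<dots> = (\<Sum>s<k. \<Sum>v<k. \<pi> (P i s) * X $$ (s, v) * \<pi> (P v j))"
        unfolding sum_distrib_right by (rule sum.swap)
      also have "\<dots> = f' i j x"
        using ij X(2) by (simp add: x_def f'_sum f'_g')
      finally show "Y $$ (i, j) = \<Psi> x $$ (i, j)" using ij by (simp add: entry)
    qed
    then show ?thesis using x by blast
  qed
  have "star_isomorphism N (corner k N ?p) \<Psi>"
    unfolding star_isomorphism_def
  proof (intro conjI ballI allI)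
    show "bij_betw \<Psi> N (corner k N ?p)"
      unfolding bij_betw_def using inj into onto by blast
    fix x assume x: "x \<in> N"
    show "\<Psi> (c *\<^sub>C x) = scaleC_mat c (\<Psi> x)" for c
      by (rule eq_matI) (auto simp: \<Psi>_def scaleC_mat_def f'_scaleC)
    show "\<Psi> (star x) = star_mat (\<Psi> x)"
      by (rule eq_matI) (auto simp: \<Psi>_def star_mat_def f'_star x)
    fix y assume y: "y \<in> N"
    show "\<Psi> (x + y) = \<Psi> x + \<Psi> y"
      by (rule eq_matI) (auto simp: \<Psi>_def f'_add)
    show "\<Psi> (x * y) = \<Psi> x * \<Psi> y"
    proof (rule eq_matI)
      fix i j assume "i < dim_row (\<Psi> x * \<Psi> y)" "j < dim_col (\<Psi> x * \<Psi> y)"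
      then have "i < k" "j < k" by (auto simp: \<Psi>_def)
      then show "\<Psi> (x * y) $$ (i, j) = (\<Psi> x * \<Psi> y) $$ (i, j)"
        using x y by (simp add: index_mult_mat_sum[OF carrier(1) carrier(1)] entry f'_mult
            del: index_mult_mat(1))
    qed (auto simp: \<Psi>_def)
  qed
  then show ?thesis using that cont(1) f'\<pi> unfolding \<Psi>_def by blast
qed

end


section \<open>Inclusion of the fundamental groups\<close>

theorem proposition6p5:
  fixes \<phi>1 \<phi>2 \<phi> :: "'a::unital_cstar_algebra \<Rightarrow> complex"
    and \<pi> :: "'a \<Rightarrow> 'h::complex_hilbert_space bounded_op" and \<xi> :: 'h
    and N :: "'h bounded_op set" and \<psi>1 \<psi>2 :: "'h bounded_op \<Rightarrow> complex"
  assumes dim2: "functional.dim (lin_C (tracial_states (UNIV :: 'a set))) = 2"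
    and faithful: "faithful_trace_space (UNIV :: 'a set)"
    and extremal_A: "extreme_points (tracial_states UNIV) = {\<phi>1, \<phi>2}" and phi_ne: "\<phi>1 \<noteq> \<phi>2"
    and phi: "\<phi> = (\<lambda>x. 1/2 * (\<phi>1 x + \<phi>2 x))"
    and GNS: "GNS_representation \<phi> \<pi> \<xi>"
    and N: "N = weak_closure_of_range \<pi>"
    and extremal_N: "extreme_points (tracial_states N) = {\<psi>1, \<psi>2}"
    and psi1: "\<psi>1 \<circ> \<pi> = \<phi>1" and psi2: "\<psi>2 \<circ> \<pi> = \<phi>2"
  shows "fundamental_group_cstar [\<phi>1, \<phi>2] \<subseteq> fundamental_group_vn N [\<psi>1, \<psi>2]"
proof
  have ext: "\<phi>1 \<in> extreme_points (tracial_states UNIV)" "\<phi>2 \<in> extreme_points (tracial_states UNIV)"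
    using extremal_A by auto
  then have T: "\<phi>1 \<in> tracial_states UNIV" "\<phi>2 \<in> tracial_states UNIV"
    by (auto simp: extreme_points_def)
  note T1 = tracial_statesD[OF T(1)] and T2 = tracial_statesD[OF T(2)]
  have nn: "0 \<le> Re (\<phi>1 (star x * x))" "0 \<le> Re (\<phi>2 (star x * x))" for x
    using T1(4)[of x] T2(4)[of x] by (auto simp: complex_nonneg_Reals_iff)
  have state: "\<phi> \<in> tracial_states UNIV"
  proof -
    have "\<phi> \<in> functionals_on UNIV"
      using T1(1) T2(1) by (simp add: functionals_on_def phi algebra_simps add_divide_distrib)
    moreover have "\<phi> (star x * x) \<in> \<real>\<^sub>\<ge>\<^sub>0" for x
      using T1(4)[of x] T2(4)[of x] by (auto simp: phi complex_nonneg_Reals_iff)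
    moreover have "\<phi> (x * y) = \<phi> (y * x)" for x y
      using T1(3)[of x y] T2(3)[of x y] by (simp add: phi)
    ultimately show ?thesis using T1(2) T2(2)
      by (auto simp: tracial_states_def positive_elements_def phi)
  qed
  interpret gns_trace \<phi> \<pi> \<xi> by unfold_locales (fact GNS state)+
  have N_eq: "N = gns_trace.N \<pi>" by (simp add: N N_def)
  have dom: "Re (\<phi>1 (star x * x)) \<le> 2 * Re (\<phi> (star x * x))"
      "Re (\<phi>2 (star x * x)) \<le> 2 * Re (\<phi> (star x * x))" for x
    using nn[of x] by (simp_all add: phi)
  obtain \<eta>1 where \<eta>1: "vector_functional \<eta>1 \<in> extreme_points (tracial_states N)"
      "vector_functional \<eta>1 \<circ> \<pi> = \<phi>1"
    using extreme_trace_extends[OF ext(1) dom(1)] N_eq by metis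
  obtain \<eta>2 where \<eta>2: "vector_functional \<eta>2 \<in> extreme_points (tracial_states N)"
      "vector_functional \<eta>2 \<circ> \<pi> = \<phi>2"
    using extreme_trace_extends[OF ext(2) dom(2)] N_eq by metis
  \<comment> \<open>Both normal extensions are extreme, and the restrictions to \<open>\<pi>(A)\<close> tell which is which.\<close>
  have \<psi>: "\<psi>1 = vector_functional \<eta>1" "\<psi>2 = vector_functional \<eta>2"
    using \<eta>1 \<eta>2 extremal_N psi1 psi2 phi_ne by auto
  fix S assume "S \<in> fundamental_group_cstar [\<phi>1, \<phi>2]"
  then obtain c k p \<Phi> where S: "S = mat 2 2 (\<lambda>(j, i). c i j)"
    and triple: "(k, p, \<Phi>) \<in> full_self_similar_triples"
    and tr: "\<forall>i<2. \<forall>x\<in>UNIV. Tr_tensor k ([\<phi>1, \<phi>2] ! i) (\<Phi> x) = (\<Sum>j<2. c i j * ([\<phi>1, \<phi>2] ! j) x)"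
    unfolding fundamental_group_cstar_def trace_matrices_def by blast
  have k: "0 < k" and p: "p \<in> carrier_mat k k" and proj: "mat_projection p"
    using triple by (auto simp: full_self_similar_triples_def self_similar_triples_def matrices_over_def)
  have two: "{..<2} = {0, 1::nat}" by auto
  obtain g n a b u t where
    entries: "full_corner_entries k (\<lambda>i j. p $$ (i, j)) (\<lambda>i j x. \<Phi> x $$ (i, j)) g n a b u t"
    using full_triple_entries[OF triple] by blast
  interpret full_corner_entries k "\<lambda>i j. p $$ (i, j)" "\<lambda>i j x. \<Phi> x $$ (i, j)" g n a b u t
    by (fact entries)
  have tr1: "matrix_trace \<phi>1 x = c 0 0 * \<phi>1 x + c 0 1 * \<phi>2 x"
    and tr2: "matrix_trace \<phi>2 x = c 1 0 * \<phi>1 x + c 1 1 * \<phi>2 x" for x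
    using tr[rule_format, of 0 x] tr[rule_format, of 1 x]
    by (simp_all add: matrix_trace_def Tr_tensor_def two)
  obtain C C' where C: "\<And>x. Re (matrix_trace \<phi> (star x * x)) \<le> C * Re (\<phi> (star x * x))"
    "\<And>x. Re (\<phi> (star x * x)) \<le> C' * Re (matrix_trace \<phi> (star x * x))"
    using matrix_trace_comparable[OF ext phi_ne tr1 tr2 phi] by metis
  interpret gns_corner \<phi> \<pi> \<xi> k "\<lambda>i j. p $$ (i, j)" "\<lambda>i j x. \<Phi> x $$ (i, j)" g n a b u t C C'
    by unfold_locales (fact C)+
  obtain f' where cont: "\<And>i j. continuous_map WOT WOT (f' i j)"
    and f': "\<And>i j x. i < k \<Longrightarrow> j < k \<Longrightarrow> f' i j (\<pi> x) = \<pi> (\<Phi> x $$ (i, j))"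
    and iso: "star_isomorphism N (corner k N (map_mat \<pi> p)) (\<lambda>x. mat k k (\<lambda>(i, j). f' i j x))"
    using corner_isomorphism_extends[OF p refl] unfolding N_eq by metis
  define \<Psi> where "\<Psi> x = mat k k (\<lambda>(i, j). f' i j x)" for x
  have "map_mat \<pi> p \<in> matrices_over k N"
    using p rep_in_N by (auto simp: matrices_over_def N_eq)
  moreover have "mat_projection (map_mat \<pi> p)"
    using GNS p proj by (intro star_projection_image) (auto simp: GNS_representation_def)
  ultimately have "(k, map_mat \<pi> p, \<Psi>) \<in> self_similar_triples N"
    using k iso by (simp add: self_similar_triples_def \<Psi>_def[abs_def])
  moreover have "\<forall>i<2. \<forall>x\<in>N. Tr_tensor k ([\<psi>1, \<psi>2] ! i) (\<Psi> x) = (\<Sum>j<2. c i j * ([\<psi>1, \<psi>2] ! j) x)"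
  proof -
    have main: "Tr_tensor k (vector_functional \<eta>) (\<Psi> x) = d1 * \<psi>1 x + d2 * \<psi>2 x"
      if x: "x \<in> N" and \<eta>: "\<And>y. matrix_trace (vector_functional \<eta> \<circ> \<pi>) y = d1 * \<phi>1 y + d2 * \<phi>2 y"
      for \<eta> d1 d2 x
    proof -
      have N_f': "f' i i y \<in> gns_trace.N \<pi>" if "i < k" "y \<in> gns_trace.N \<pi>" for i y
        by (rule maps_N_into_N[OF cont _ that(2)]) (simp add: f' that rep_in_N)
      have "(\<Sum>i<k. cinner (apply_op (f' i i x) \<xi>) \<eta>) =
        d1 * cinner (apply_op x \<xi>) \<eta>1 + d2 * cinner (apply_op x \<xi>) \<eta>2"
      proof (rule functional_eq_on_N)
        show "x \<in> gns_trace.N \<pi>" using x N_eq by simp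
        show "continuous_map WOT euclidean (\<lambda>x. \<Sum>i<k. cinner (apply_op (f' i i x) \<xi>) \<eta>)"
          by (intro continuous_map_sum continuous_map_WOT_functional cont) auto
        show "continuous_map WOT euclidean
          (\<lambda>x. d1 * cinner (apply_op x \<xi>) \<eta>1 + d2 * cinner (apply_op x \<xi>) \<eta>2)"
        proof -
          have "continuous_map WOT euclidean (\<lambda>x. cinner (apply_op (e *\<^sub>C x) \<xi>) \<eta>)" for e \<eta>
            by (intro continuous_map_WOT_functional WOT_intros)
          then show ?thesis by (intro continuous_map_add) (simp_all add: cinner_scaleC_left)
        qed
        fix y
        have "cinner (apply_op (\<pi> y) \<xi>) \<eta>1 = \<phi>1 y" "cinner (apply_op (\<pi> y) \<xi>) \<eta>2 = \<phi>2 y"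
          using fun_cong[OF \<eta>1(2), of y] fun_cong[OF \<eta>2(2), of y]
          by (simp_all add: vector_functional_on_N rep_in_N)
        then show "(\<Sum>i<k. cinner (apply_op (f' i i (\<pi> y)) \<xi>) \<eta>) =
          d1 * cinner (apply_op (\<pi> y) \<xi>) \<eta>1 + d2 * cinner (apply_op (\<pi> y) \<xi>) \<eta>2"
          using \<eta>[of y] by (simp add: matrix_trace_def f' vector_functional_on_N rep_in_N)
      qed
      then show ?thesis
        using x N_f' by (simp add: Tr_tensor_def \<Psi>_def \<psi> N_eq vector_functional_on_N)
    qed
    have "Tr_tensor k \<psi>1 (\<Psi> x) = c 0 0 * \<psi>1 x + c 0 1 * \<psi>2 x" if "x \<in> N" for x
      using main[OF that, of \<eta>1 "c 0 0" "c 0 1"] tr1 \<eta>1(2) \<psi>(1) by simp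
    moreover have "Tr_tensor k \<psi>2 (\<Psi> x) = c 1 0 * \<psi>1 x + c 1 1 * \<psi>2 x" if "x \<in> N" for x
      using main[OF that, of \<eta>2 "c 1 0" "c 1 1"] tr2 \<eta>2(2) \<psi>(2) by simp
    ultimately show ?thesis by (auto simp: two less_2_cases_iff)
  qed
  ultimately show "S \<in> fundamental_group_vn N [\<psi>1, \<psi>2]"
    unfolding fundamental_group_vn_def trace_matrices_def S by blast
qed

end
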